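(* Let $0<\mu\le1$, let $\epsilon>0$, and let $d$ be a positive integer. Then there are constants $C=C(\mu,\epsilon,d)\ge1$ and $k_0=k_0(\mu,\epsilon,d)\ge1$ such that the following holds. Let $k\ge k_0$ be an integer and let $\mathbf v=\{v_1,\dots,v_n\}$ be a multiset of integers such that $\mathbb P_\mu(\mathbf v)\ge C k^{-d}$. Then there exists a generalized arithmetic progression $Q$ with the following properties: (1) the rank of $Q$ is at most $d-1$; (2) the volume of $Q$ is at most $k^{2(d^2-1)+\epsilon}$; (3) $Q$ contains all but at most $\epsilon k^2\log k$ elements of $\mathbf v$ (counting multiplicity); (4) there exists a positive integer $s$ at most $k^{d+\epsilon}$ such that $su\in\mathbf v$ for each generator $u$ of $Q$.
   Context: For $0\le\mu\le1$, $\eta^\mu$ is a random variable equal to $0$ with probability $1-\mu$ and to $+1$, $-1$ with probability $\mu/2$ each. For a multiset $\mathbf v=\{v_1,\dots,v_n\}$ of integers, $\mathbb P_\mu(\mathbf v):=\max_{a\in\mathbb Z}\mathbf P(\sum_{i=1}^n\eta_i^\mu v_i=a)$, where the $\eta^\mu_i$ are i.i.d. copies of $\eta^\mu$. A generalized arithmetic progression (GAP) of rank $d$ is a set $P=\{c+m_1a_1+\dots+m_da_d: m_i\in\mathbb Z,\ M_i\le m_i\le M_i'\}$ (given together with this presentation, $M_i \le M_i'$ integers). The numbers $a_i$ are its generators (all GAPs here have rational generators), and its volume is $\prod_{i=1}^d(M_i'-M_i+1)$. A rank $0$ GAP is a single point, with volume $1$ and no generators. *)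

theory Defs
  imports "HOL-Probability.Probability"
begin

definition eta_pmf :: "real \<Rightarrow> int pmf" where
  "eta_pmf \<mu> = bernoulli_pmf \<mu> \<bind> (\<lambda>b. if b then pmf_of_set {1, -1} else return_pmf 0)"

lemma pmf_eta_pmf:
  assumes "0 \<le> \<mu>" "\<mu> \<le> 1"
  shows "pmf (eta_pmf \<mu>) 0 = 1 - \<mu>"
    and "pmf (eta_pmf \<mu>) 1 = \<mu> / 2"
    and "pmf (eta_pmf \<mu>) (-1) = \<mu> / 2"
  using assms by (simp_all add: eta_pmf_def pmf_bind indicator_def)

lemma set_pmf_eta_pmf: "set_pmf (eta_pmf \<mu>) \<subseteq> {-1, 0, 1}"
  by (auto simp: eta_pmf_def split: if_splits)

text \<open>
  The multiset is represented by an enumeration \<open>v\<close> of its elements. \<open>walk_pmf \<mu> v\<close> is the law of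
  the sum of the \<open>\<eta>\<^sub>i * v ! i\<close>, where \<open>Pi_pmf\<close> makes the \<open>\<eta>\<^sub>i\<close> independent
  (its argument \<open>0\<close> is only the value taken outside of the index set).
\<close>

definition walk_pmf :: "real \<Rightarrow> int list \<Rightarrow> int pmf" where
  "walk_pmf \<mu> v =
     map_pmf (\<lambda>\<eta>. \<Sum>i<length v. \<eta> i * v ! i) (Pi_pmf {..<length v} 0 (\<lambda>_. eta_pmf \<mu>))"

definition max_prob :: "real \<Rightarrow> int list \<Rightarrow> real" where
  "max_prob \<mu> v = Max (range (pmf (walk_pmf \<mu> v)))"

text \<open>The maximum is taken over a finite set of values, so that \<open>Max\<close> is meaningful.\<close>

lemma finite_range_pmf_walk_pmf: "finite (range (pmf (walk_pmf \<mu> v)))"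
proof -
  have "finite (set_pmf (eta_pmf \<mu>))"
    using set_pmf_eta_pmf by (rule finite_subset) simp
  then have "finite (set_pmf (walk_pmf \<mu> v))"
    by (auto simp: walk_pmf_def set_Pi_pmf intro!: finite_imageI finite_PiE_dflt)
  moreover have "range (pmf (walk_pmf \<mu> v)) \<subseteq>
      insert 0 (pmf (walk_pmf \<mu> v) ` set_pmf (walk_pmf \<mu> v))"
    by (auto simp: set_pmf_iff)
  ultimately show ?thesis
    by (meson finite.insertI finite_imageI finite_subset)
qed

text \<open>
  A GAP is kept together with its presentation; only the indices \<open>i < gap_rank Q\<close> of the last three
  components matter.
\<close>

record gap =
  gap_rank :: nat
  gap_base :: rat
  gap_gen :: "nat \<Rightarrow> rat"
  gap_lo :: "nat \<Rightarrow> int"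
  gap_hi :: "nat \<Rightarrow> int"

definition is_gap :: "gap \<Rightarrow> bool" where
  "is_gap Q \<longleftrightarrow> (\<forall>i<gap_rank Q. gap_lo Q i \<le> gap_hi Q i)"

definition gap_set :: "gap \<Rightarrow> rat set" where
  "gap_set Q = {gap_base Q + (\<Sum>i<gap_rank Q. of_int (m i) * gap_gen Q i) | m :: nat \<Rightarrow> int.
     \<forall>i<gap_rank Q. gap_lo Q i \<le> m i \<and> m i \<le> gap_hi Q i}"

definition gap_volume :: "gap \<Rightarrow> int" where
  "gap_volume Q = (\<Prod>i<gap_rank Q. gap_hi Q i - gap_lo Q i + 1)"

definition gap_generators :: "gap \<Rightarrow> rat set" where
  "gap_generators Q = gap_gen Q ` {..<gap_rank Q}"

end

theory Submission
  imports Defs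
begin

text \<open>
  Write \<open>\<nu> = \<mu> / 4\<close>. From \<open>v\<close> one extracts a short list of elements
  \<open>x\<^sub>0, \<dots>, x\<^sub>m\<^sub>-\<^sub>1\<close> with integers \<open>T < p\<^sub>l \<le> k\<close>, where \<open>T\<close> is a large constant, such that
  all sums \<open>\<Sum>n\<^sub>l x\<^sub>l\<close> with \<open>0 \<le> n\<^sub>l < p\<^sub>l\<close> are distinct. Each element \<open>x\<^sub>l\<close> is paid for by discarding
  \<open>k\<^sup>2\<close> elements of \<open>v\<close>: on the Fourier side all factors of the characteristic function may be taken
  positive, and by the inequality between arithmetic and geometric mean a product of \<open>k\<^sup>2\<close> of them can be
  replaced by the \<open>k\<^sup>2\<close>-th power of a single one (\<open>exists_factor_repeated\<close>). Hence \<open>\<P>\<^sub>\<mu>(v)\<close> is at most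
  the probability that \<open>\<Sum>X\<^sub>l x\<^sub>l = 0\<close>, where the \<open>X\<^sub>l\<close> are independent lazy walks of \<open>k\<^sup>2\<close> steps.

  Cut the range of \<open>X\<^sub>l\<close> into blocks of length \<open>p\<^sub>l\<close>. A product of blocks contains at most one solution of
  \<open>\<Sum>n\<^sub>l x\<^sub>l = 0\<close>, so this probability is at most the product over \<open>l\<close> of the sum, over all blocks, of the
  largest point mass in the block. As the walk is unimodal with point masses \<open>O(1 / k)\<close>, the \<open>l\<close>-th
  factor is \<open>O(1 / p\<^sub>l)\<close> (\<open>dissociated_return_le\<close>, \<open>sum_block_bound_le\<close>). No truncation of the
  walk is involved.

  The list is built greedily: \<open>y\<close> can be appended as long as no multiple \<open>b y\<close> with \<open>1 \<le> b \<le> T\<close> is a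
  combination \<open>\<Sum>n\<^sub>l x\<^sub>l\<close> with \<open>\<bar>n\<^sub>l\<bar> < p\<^sub>l\<close>. Its \<open>p\<close> is the least \<open>b\<close> for which \<open>b y\<close> is such a
  combination; then \<open>y\<close> is tied to its predecessors. If there is no such \<open>b < k\<close>, put \<open>p = k\<close>. An index
  that is not tied is free. When the list is maximal, fewer than \<open>(m + 1) k\<^sup>2\<close> elements of \<open>v\<close> fail to be
  captured, that is, to have a multiple \<open>b y\<close> as above (\<open>chain_extraction\<close>).

  With \<open>r\<close> free indices and \<open>s\<^sub>0\<close> the product of the \<open>p\<^sub>l\<close> over the tied ones, the bound on the
  probability reads \<open>C k\<^sup>-\<^sup>d \<le> O(1 / k)\<^sup>r s\<^sub>0\<^sup>-\<^sup>1\<^sup>+\<^sup>\<delta>\<close>, since every factor \<open>O(1 / p\<^sub>l)\<close> is at most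
  \<open>p\<^sub>l\<^sup>-\<^sup>1\<^sup>+\<^sup>\<delta>\<close> once \<open>T\<close> is large. So \<open>r < d\<close>, \<open>s\<^sub>0\<close> is at most about \<open>k\<^sup>d\<close>, and \<open>m\<close> is at most
  \<open>d + O(log k / log T)\<close> (\<open>chain_size_bounds\<close>).

  Each tied \<open>x\<^sub>l\<close> is a rational combination of its predecessors, hence of the free elements. The
  condition \<open>\<bar>n\<^sub>l\<bar> < p\<^sub>l\<close> keeps the coordinates at most \<open>2\<^sup>m k\<close>, and \<open>s\<^sub>0\<close> clears their denominators. A
  captured element thus lies in the GAP generated by the elements \<open>x\<^sub>i / s\<close> with \<open>i\<close> free, where
  \<open>s = s\<^sub>0 T!\<close> (\<open>captured_coordinates\<close>). As \<open>2\<^sup>m\<close> and \<open>T!\<close> are bounded by small powers of \<open>k\<close>, the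
  bounds on the volume and on \<open>s\<close> follow, with room to spare for the volume.
\<close>

section \<open>The lazy random walk\<close>

text \<open>
  \<open>lazy_walk \<nu> n b\<close> is the probability that \<open>n\<close> independent copies of \<open>\<eta>\<^sup>\<nu>\<close> sum to \<open>b\<close>. Only a few
  elementary facts about it are needed, and all of them follow from the recursion on the last step.
\<close>

primrec lazy_walk :: "real \<Rightarrow> nat \<Rightarrow> int \<Rightarrow> real" where
  "lazy_walk \<nu> 0 b = (if b = 0 then 1 else 0)"
| "lazy_walk \<nu> (Suc n) b =
     (1 - \<nu>) * lazy_walk \<nu> n b + \<nu> / 2 * (lazy_walk \<nu> n (b - 1) + lazy_walk \<nu> n (b + 1))"

lemma lazy_walk_nonneg: "0 \<le> \<nu> \<Longrightarrow> \<nu> \<le> 1 \<Longrightarrow> 0 \<le> lazy_walk \<nu> n b"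
  by (induction n arbitrary: b) auto

lemma lazy_walk_support: "\<bar>b\<bar> > int n \<Longrightarrow> lazy_walk \<nu> n b = 0"
  by (induction n arbitrary: b) auto

lemma lazy_walk_uminus: "lazy_walk \<nu> n (- b) = lazy_walk \<nu> n b"
proof (induction n arbitrary: b)
  case (Suc n)
  have "lazy_walk \<nu> n (- b - 1) = lazy_walk \<nu> n (b + 1)"
  proof -
    have "- b - 1 = - (b + 1)" by simp
    then show ?thesis by (simp only: Suc.IH)
  qed
  moreover have "lazy_walk \<nu> n (- b + 1) = lazy_walk \<nu> n (b - 1)"
  proof -
    have "- b + 1 = - (b - 1)" by simp
    then show ?thesis by (simp only: Suc.IH)
  qed
  ultimately show ?case using Suc.IH[of b] by simp
qed simp

text \<open>
  Unimodality survives a step because staying put is at least as likely as moving to either side; at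
  the origin the step from \<open>-1\<close> is the one that needs this.
\<close>

lemma lazy_walk_decreasing_step:
  assumes "0 \<le> \<nu>" "\<nu> \<le> 1 / 2" "0 \<le> b"
  shows "lazy_walk \<nu> n (b + 1) \<le> lazy_walk \<nu> n b"
  using assms(3)
proof (induction n arbitrary: b)
  case (Suc n)
  define f where "f = lazy_walk \<nu> n"
  have 1: "f (b + 1) \<le> f b" and 2: "f (b + 2) \<le> f (b + 1)"
    using Suc.IH[of b] Suc.IH[of "b + 1"] Suc.prems by (simp_all add: f_def algebra_simps)
  show ?case
  proof (cases "b = 0")
    case True
    have "f (-1) = f 1" using lazy_walk_uminus[of \<nu> n 1] by (simp add: f_def)
    moreover have "(1 - \<nu> - \<nu> / 2) * (f 0 - f 1) \<ge> 0" "\<nu> / 2 * (f 1 - f 2) \<ge> 0"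
      using 1 2 assms True by (auto intro!: mult_nonneg_nonneg)
    moreover have "lazy_walk \<nu> (Suc n) b - lazy_walk \<nu> (Suc n) (b + 1)
        = (1 - \<nu> - \<nu> / 2) * (f 0 - f 1) + \<nu> / 2 * (f 1 - f 2)"
      using True \<open>f (-1) = f 1\<close> by (simp add: f_def[symmetric] field_simps)
    ultimately show ?thesis by linarith
  next
    case False
    have 3: "f b \<le> f (b - 1)" using Suc.IH[of "b - 1"] False Suc.prems by (simp add: f_def)
    have "(1 - \<nu>) * (f b - f (b + 1)) \<ge> 0" "\<nu> / 2 * (f (b - 1) - f b) \<ge> 0"
      "\<nu> / 2 * (f (b + 1) - f (b + 2)) \<ge> 0"
      using 1 2 3 assms by (auto intro!: mult_nonneg_nonneg)
    moreover have "lazy_walk \<nu> (Suc n) b - lazy_walk \<nu> (Suc n) (b + 1)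
        = (1 - \<nu>) * (f b - f (b + 1)) + \<nu> / 2 * (f (b - 1) - f b) + \<nu> / 2 * (f (b + 1) - f (b + 2))"
      by (simp add: f_def[symmetric] field_simps)
    ultimately show ?thesis by linarith
  qed
qed auto

lemma lazy_walk_antimono_abs:
  assumes "0 \<le> \<nu>" "\<nu> \<le> 1 / 2" "\<bar>a\<bar> \<le> \<bar>b\<bar>"
  shows "lazy_walk \<nu> n b \<le> lazy_walk \<nu> n a"
proof -
  have mono: "lazy_walk \<nu> n (int j) \<le> lazy_walk \<nu> n (int i)" if "i \<le> j" for i j
    using that
  proof (induction j rule: dec_induct)
    case (step j)
    then show ?case
      using lazy_walk_decreasing_step[OF assms(1,2), of "int j" n] by (simp add: add.commute)
  qed simp
  have abs: "lazy_walk \<nu> n c = lazy_walk \<nu> n (int (nat \<bar>c\<bar>))" for c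
    using lazy_walk_uminus[of \<nu> n c] by (auto simp: abs_if)
  show ?thesis
    using mono[of "nat \<bar>a\<bar>" "nat \<bar>b\<bar>"] assms(3) abs[of a] abs[of b] by simp
qed

lemma sum_lazy_walk_shift:
  fixes g :: "int \<Rightarrow> 'a :: real_vector"
  assumes "int n < N" "\<bar>e\<bar> = 1"
  shows "(\<Sum>b\<in>{-N..N}. lazy_walk \<nu> n (b + e) *\<^sub>R g b) = (\<Sum>b\<in>{-N..N}. lazy_walk \<nu> n b *\<^sub>R g (b - e))"
proof -
  have "(\<Sum>b\<in>{-N..N}. lazy_walk \<nu> n (b + e) *\<^sub>R g b)
      = (\<Sum>b\<in>{-N + e..N + e}. lazy_walk \<nu> n b *\<^sub>R g (b - e))"
    by (rule sum.reindex_bij_witness[of _ "\<lambda>b. b - e" "\<lambda>b. b + e"]) auto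
  also have "\<dots> = (\<Sum>b\<in>{-N..N} \<inter> {-N + e..N + e}. lazy_walk \<nu> n b *\<^sub>R g (b - e))"
    using assms by (intro sum.mono_neutral_right) (auto intro!: lazy_walk_support)
  also have "\<dots> = (\<Sum>b\<in>{-N..N}. lazy_walk \<nu> n b *\<^sub>R g (b - e))"
    using assms by (intro sum.mono_neutral_left) (auto intro!: lazy_walk_support)
  finally show ?thesis .
qed

text \<open>
  One step of the walk moved from the weights to the test function \<open>g\<close>. The characteristic function and
  the first two moments come from taking for \<open>g\<close> a character, the absolute value and the square.
\<close>

lemma sum_lazy_walk_Suc:
  fixes g :: "int \<Rightarrow> 'a :: real_vector"
  assumes "int n < N"
  shows "(\<Sum>b\<in>{-N..N}. lazy_walk \<nu> (Suc n) b *\<^sub>R g b) =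
    (\<Sum>b\<in>{-N..N}. lazy_walk \<nu> n b *\<^sub>R ((1 - \<nu>) *\<^sub>R g b + (\<nu> / 2) *\<^sub>R (g (b - 1) + g (b + 1))))"
proof -
  have "(\<Sum>b\<in>{-N..N}. lazy_walk \<nu> (Suc n) b *\<^sub>R g b) =
      (1 - \<nu>) *\<^sub>R (\<Sum>b\<in>{-N..N}. lazy_walk \<nu> n b *\<^sub>R g b)
      + (\<nu> / 2) *\<^sub>R ((\<Sum>b\<in>{-N..N}. lazy_walk \<nu> n (b - 1) *\<^sub>R g b)
      + (\<Sum>b\<in>{-N..N}. lazy_walk \<nu> n (b + 1) *\<^sub>R g b))"
    by (simp add: scaleR_sum_right scaleR_add_right scaleR_add_left sum.distrib distrib_left add_divide_distrib)
  also have "(\<Sum>b\<in>{-N..N}. lazy_walk \<nu> n (b - 1) *\<^sub>R g b) = (\<Sum>b\<in>{-N..N}. lazy_walk \<nu> n b *\<^sub>R g (b + 1))"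
    using sum_lazy_walk_shift[OF assms, of "-1" \<nu> g] by simp
  also have "(\<Sum>b\<in>{-N..N}. lazy_walk \<nu> n (b + 1) *\<^sub>R g b) = (\<Sum>b\<in>{-N..N}. lazy_walk \<nu> n b *\<^sub>R g (b - 1))"
    using sum_lazy_walk_shift[OF assms, of "1" \<nu> g] by simp
  finally show ?thesis
    by (simp add: scaleR_sum_right scaleR_add_right sum.distrib mult.commute add.commute)
qed

lemma sum_lazy_walk_cis:
  assumes "int n \<le> N"
  shows "(\<Sum>b\<in>{-N..N}. lazy_walk \<nu> n b *\<^sub>R cis (of_int b * \<theta>)) = of_real ((1 - \<nu> + \<nu> * cos \<theta>) ^ n)"
  using assms
proof (induction n)
  case 0
  have "(\<Sum>b\<in>{-N..N}. lazy_walk \<nu> 0 b *\<^sub>R cis (of_int b * \<theta>)) =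
      (\<Sum>b\<in>{-N..N}. if b = 0 then 1 else 0)"
    by (intro sum.cong) auto
  then show ?case using 0 by simp
next
  case (Suc n)
  have step: "(1 - \<nu>) *\<^sub>R cis (of_int b * \<theta>) + (\<nu> / 2) *\<^sub>R (cis (of_int (b - 1) * \<theta>) + cis (of_int (b + 1) * \<theta>))
      = of_real (1 - \<nu> + \<nu> * cos \<theta>) * cis (of_int b * \<theta>)" for b
    by (simp add: complex_eq_iff algebra_simps cos_add sin_add cos_diff sin_diff)
  have "(\<Sum>b\<in>{-N..N}. lazy_walk \<nu> (Suc n) b *\<^sub>R cis (of_int b * \<theta>)) =
      (\<Sum>b\<in>{-N..N}. lazy_walk \<nu> n b *\<^sub>R (of_real (1 - \<nu> + \<nu> * cos \<theta>) * cis (of_int b * \<theta>)))"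
    unfolding step[symmetric] using Suc.prems by (intro sum_lazy_walk_Suc) auto
  also have "\<dots> = of_real (1 - \<nu> + \<nu> * cos \<theta>) * (\<Sum>b\<in>{-N..N}. lazy_walk \<nu> n b *\<^sub>R cis (of_int b * \<theta>))"
    by (simp add: sum_distrib_left)
  finally show ?case using Suc by simp
qed

lemma sum_lazy_walk: "int n \<le> N \<Longrightarrow> (\<Sum>b\<in>{-N..N}. lazy_walk \<nu> n b) = 1"
  using arg_cong[OF sum_lazy_walk_cis[of n N \<nu> 0], of Re] by simp

lemma lazy_walk_variance:
  assumes "int n \<le> N"
  shows "(\<Sum>b\<in>{-N..N}. lazy_walk \<nu> n b * (real_of_int b)\<^sup>2) = \<nu> * n"
  using assms
proof (induction n)
  case 0
  then show ?case by (intro trans[OF sum.neutral]) auto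
next
  case (Suc n)
  have "(\<Sum>b\<in>{-N..N}. lazy_walk \<nu> (Suc n) b * (real_of_int b)\<^sup>2)
      = (\<Sum>b\<in>{-N..N}. lazy_walk \<nu> n b * ((real_of_int b)\<^sup>2 + \<nu>))"
    using Suc.prems sum_lazy_walk_Suc[of n N \<nu> "\<lambda>b. (real_of_int b)\<^sup>2"]
    by (simp add: power2_eq_square algebra_simps)
  also have "\<dots> = \<nu> * n + \<nu>"
    using Suc sum_lazy_walk[of n N \<nu>] by (simp add: algebra_simps sum.distrib flip: sum_distrib_left)
  finally show ?case by (simp add: algebra_simps)
qed

text \<open>
  A discrete Tanaka formula: \<open>\<bar>b\<bar>\<close> is harmonic away from \<open>0\<close>, so the first absolute moment grows
  only through visits to the origin.
\<close>

lemma lazy_walk_first_moment: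
  assumes "int n \<le> N"
  shows "(\<Sum>b\<in>{-N..N}. lazy_walk \<nu> n b * \<bar>real_of_int b\<bar>) = \<nu> * (\<Sum>i<n. lazy_walk \<nu> i 0)"
  using assms
proof (induction n)
  case 0
  then show ?case by (intro trans[OF sum.neutral]) auto
next
  case (Suc n)
  have tanaka: "(1 - \<nu>) * \<bar>real_of_int b\<bar> + \<nu> / 2 * (\<bar>real_of_int (b - 1)\<bar> + \<bar>real_of_int (b + 1)\<bar>)
      = \<bar>real_of_int b\<bar> + (if b = 0 then \<nu> else 0)" for b
  proof -
    consider "b = 0" | "b \<ge> 1" | "b = -1" | "b \<le> -2" by linarith
    then show ?thesis by cases (auto simp: abs_if field_simps)
  qed
  have "(\<Sum>b\<in>{-N..N}. lazy_walk \<nu> (Suc n) b * \<bar>real_of_int b\<bar>)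
      = (\<Sum>b\<in>{-N..N}. lazy_walk \<nu> n b * (\<bar>real_of_int b\<bar> + (if b = 0 then \<nu> else 0)))"
    unfolding tanaka[symmetric] using Suc.prems sum_lazy_walk_Suc[of n N \<nu> "\<lambda>b. \<bar>real_of_int b\<bar>"] by simp
  also have "\<dots> = (\<Sum>b\<in>{-N..N}. lazy_walk \<nu> n b * \<bar>real_of_int b\<bar>)
      + (\<Sum>b\<in>{-N..N}. lazy_walk \<nu> n b * (if b = 0 then \<nu> else 0))"
    by (simp only: distrib_left sum.distrib)
  also have "(\<Sum>b\<in>{-N..N}. lazy_walk \<nu> n b * (if b = 0 then \<nu> else 0)) = \<nu> * lazy_walk \<nu> n 0"
    using Suc.prems by (simp add: if_distrib cong: if_cong)
  also have "(\<Sum>b\<in>{-N..N}. lazy_walk \<nu> n b * \<bar>real_of_int b\<bar>) + \<nu> * lazy_walk \<nu> n 0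
      = \<nu> * (\<Sum>i<Suc n. lazy_walk \<nu> i 0)"
    using Suc by (simp add: algebra_simps)
  finally show ?case .
qed

text \<open>
  The return probabilities decrease in time, so \<open>n\<close> times the last one is at most the expected number of
  visits to \<open>0\<close>. By the previous lemma this is the first moment divided by \<open>\<nu>\<close>, and the first moment
  is at most the standard deviation \<open>\<surd>(\<nu> n)\<close>.
\<close>

lemma lazy_walk_at_zero_le:
  assumes "0 < \<nu>" "\<nu> \<le> 1 / 2" "0 < n"
  shows "lazy_walk \<nu> n 0 \<le> 1 / sqrt (\<nu> * n)"
proof -
  have dec: "lazy_walk \<nu> n 0 \<le> lazy_walk \<nu> i 0" if "i \<le> n" for i
    using that
  proof (induction n rule: dec_induct)
    case (step j)
    have "lazy_walk \<nu> (Suc j) 0 = lazy_walk \<nu> j 0 - \<nu> * (lazy_walk \<nu> j 0 - lazy_walk \<nu> j 1)"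
      using lazy_walk_uminus[of \<nu> j 1] by (simp add: algebra_simps)
    also have "\<dots> \<le> lazy_walk \<nu> j 0"
      using assms lazy_walk_antimono_abs[of \<nu> 0 1 j] by simp
    finally show ?case using step by simp
  qed simp
  define t where "t = sqrt (\<nu> * n)"
  have t: "t > 0" "t * t = \<nu> * n" using assms by (auto simp: t_def)
  have "\<nu> * (real n * lazy_walk \<nu> n 0) = \<nu> * (\<Sum>i<n. lazy_walk \<nu> n 0)" by simp
  also have "\<dots> \<le> \<nu> * (\<Sum>i<n. lazy_walk \<nu> i 0)"
    using assms dec by (intro mult_left_mono sum_mono) auto
  also have "\<dots> = (\<Sum>b\<in>{-int n..int n}. lazy_walk \<nu> n b * \<bar>real_of_int b\<bar>)"
    by (rule lazy_walk_first_moment[symmetric]) simp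
  also have "\<dots> \<le> (\<Sum>b\<in>{-int n..int n}. lazy_walk \<nu> n b * ((real_of_int b)\<^sup>2 / (2 * t) + t / 2))"
  proof (intro sum_mono mult_left_mono lazy_walk_nonneg)
    fix b :: int
    \<comment> \<open>Cauchy-Schwarz in the form of the weighted inequality \<open>2 t \<bar>b\<bar> \<le> b\<^sup>2 + t\<^sup>2\<close>.\<close>
    have "0 \<le> (\<bar>real_of_int b\<bar> - t)\<^sup>2 / (2 * t)" using t by simp
    then show "\<bar>real_of_int b\<bar> \<le> (real_of_int b)\<^sup>2 / (2 * t) + t / 2"
      using t by (simp add: field_simps power2_eq_square)
  qed (use assms in auto)
  also have "\<dots> = (\<Sum>b\<in>{-int n..int n}. lazy_walk \<nu> n b * (real_of_int b)\<^sup>2) / (2 * t)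
      + (\<Sum>b\<in>{-int n..int n}. lazy_walk \<nu> n b) * (t / 2)"
    by (simp add: ring_distribs sum.distrib sum_divide_distrib sum_distrib_right)
  also have "\<dots> = t * t / (2 * t) + t / 2"
    by (simp only: lazy_walk_variance[OF order_refl] sum_lazy_walk[OF order_refl] t(2))
  also have "\<dots> = t" using t(1) by simp
  also have "\<nu> * (real n * lazy_walk \<nu> n 0) = t * (t * lazy_walk \<nu> n 0)"
    by (simp only: mult.assoc[symmetric] t(2))
  finally have "t * (t * lazy_walk \<nu> n 0) \<le> t * 1" by simp
  then have "t * lazy_walk \<nu> n 0 \<le> 1" using t(1) by (simp only: mult_le_cancel_left_pos)
  then show ?thesis using t by (simp add: field_simps flip: t_def)
qed

text \<open>
  A bound for the point masses in the block \<open>{t p..<(t + 1) p}\<close>: the value at its end nearer to the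
  origin. For negative \<open>t\<close> the excluded end point \<open>(t + 1) p\<close> is used, which makes the bound invariant
  under \<open>t \<mapsto> - t - 1\<close>.
\<close>

definition block_bound :: "real \<Rightarrow> nat \<Rightarrow> nat \<Rightarrow> int \<Rightarrow> real" where
  "block_bound \<nu> n p t = lazy_walk \<nu> n (if 0 \<le> t then t * int p else (t + 1) * int p)"

lemma lazy_walk_le_block_bound:
  assumes "0 \<le> \<nu>" "\<nu> \<le> 1 / 2" "0 < p"
  shows "lazy_walk \<nu> n b \<le> block_bound \<nu> n p (b div int p)"
proof -
  have b: "b = (b div int p) * int p + b mod int p" by simp
  have mod: "0 \<le> b mod int p" "b mod int p < int p" using assms by simp_all
  show ?thesis
  proof (cases "0 \<le> b div int p")
    case True
    then have "0 \<le> (b div int p) * int p" by simp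
    then have "\<bar>(b div int p) * int p\<bar> \<le> \<bar>b\<bar>" using b mod by linarith
    then show ?thesis using True assms by (simp add: block_bound_def lazy_walk_antimono_abs)
  next
    case False
    then have "(b div int p + 1) * int p \<le> 0" by (intro mult_nonpos_nonneg) auto
    moreover have "(b div int p + 1) * int p = b div int p * int p + int p" by (simp add: ring_distribs)
    then have "b \<le> (b div int p + 1) * int p" using b mod by linarith
    ultimately have "\<bar>(b div int p + 1) * int p\<bar> \<le> \<bar>b\<bar>" by linarith
    then show ?thesis using False assms by (simp add: block_bound_def lazy_walk_antimono_abs)
  qed
qed

text \<open>
  On the positive side, the bound for a block is by unimodality at most the average over the block before
  it, and these averages sum to at most \<open>1 / p\<close>. Only the block at the origin has no such predecessor; it
  contributes the value at \<open>0\<close>. The negative side is the mirror image.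
\<close>

lemma sum_block_bound_le:
  assumes "0 \<le> \<nu>" "\<nu> \<le> 1 / 2" "0 < p"
  shows "(\<Sum>t\<in>{-int n..int n}. block_bound \<nu> n p t) \<le> 2 * lazy_walk \<nu> n 0 + 2 / p"
proof -
  let ?f = "lazy_walk \<nu> n"
  have nn: "0 \<le> ?f b" for b using assms by (intro lazy_walk_nonneg) auto
  define S where "S = (\<Sum>t<n. ?f (int (Suc t) * int p))"
  have "real p * S = (\<Sum>t<n. \<Sum>r<p. ?f (int (Suc t) * int p))"
    by (simp add: S_def sum_distrib_left)
  also have "\<dots> \<le> (\<Sum>t<n. \<Sum>r<p. ?f (int (r + t * p)))"
    using assms by (intro sum_mono lazy_walk_antimono_abs) (auto simp: algebra_simps)
  also have "\<dots> = (\<Sum>b<n * p. ?f (int b))"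
  proof -
    have "(\<Sum>r<p. ?f (int (r + t * p))) = (\<Sum>b = t * p..<t * p + p. ?f (int b))" for t
      using sum.shift_bounds_nat_ivl[of "\<lambda>b. ?f (int b)" 0 "t * p" p]
      by (simp add: atLeast0LessThan add.commute)
    then show ?thesis by (simp only: sum.nat_group)
  qed
  also have "\<dots> = (\<Sum>b\<in>int ` {..<n * p}. ?f b)"
    by (simp add: sum.reindex)
  also have "\<dots> \<le> (\<Sum>b\<in>{-int (n * p)..int (n * p)}. ?f b)"
    using nn by (intro sum_mono2) (auto simp del: of_nat_mult)
  also have "\<dots> = 1" using assms by (intro sum_lazy_walk) (simp del: of_nat_mult)
  finally have S: "S \<le> 1 / p" using assms by (simp add: field_simps)
  have pos: "(\<Sum>t\<in>{0..int n}. block_bound \<nu> n p t) = ?f 0 + S"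
  proof -
    have "(\<Sum>t\<in>{0..int n}. block_bound \<nu> n p t) = (\<Sum>t\<in>int ` {..n}. block_bound \<nu> n p t)"
      by (simp add: image_int_atLeastAtMost atMost_atLeast0)
    also have "\<dots> = (\<Sum>t\<le>n. ?f (int t * int p))"
      by (simp add: sum.reindex block_bound_def)
    also have "\<dots> = ?f 0 + S"
      unfolding S_def by (simp add: sum.atMost_shift)
    finally show ?thesis .
  qed
  have "(\<Sum>t\<in>{-int n..-1}. block_bound \<nu> n p t) \<le> ?f 0 + S"
  proof -
    have "(\<Sum>t\<in>{-int n..-1}. block_bound \<nu> n p t) = (\<Sum>t\<in>{0..int n - 1}. block_bound \<nu> n p t)"
    proof (rule sum.reindex_bij_witness[of _ "\<lambda>t. - t - 1" "\<lambda>t. - t - 1"])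
      fix t assume "t \<in> {-int n..-1}"
      moreover have "(- t - 1) * int p = - ((t + 1) * int p)" by (simp add: algebra_simps)
      ultimately show "block_bound \<nu> n p (- t - 1) = block_bound \<nu> n p t"
        by (simp add: block_bound_def lazy_walk_uminus del: minus_diff_eq mult_minus_left)
    qed auto
    also have "\<dots> \<le> (\<Sum>t\<in>{0..int n}. block_bound \<nu> n p t)"
      using nn by (intro sum_mono2) (auto simp: block_bound_def)
    finally show ?thesis using pos by simp
  qed
  moreover have "(\<Sum>t\<in>{-int n..int n}. block_bound \<nu> n p t) =
      (\<Sum>t\<in>{-int n..-1}. block_bound \<nu> n p t) + (\<Sum>t\<in>{0..int n}. block_bound \<nu> n p t)"
    by (subst sum.union_disjoint[symmetric]) (auto intro!: sum.cong)
  ultimately show ?thesis using pos S by simp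
qed


section \<open>Dissociated sequences\<close>

definition bounded_combinations :: "(nat \<Rightarrow> int) \<Rightarrow> (nat \<Rightarrow> nat) \<Rightarrow> nat \<Rightarrow> int set" where
  "bounded_combinations x p l = {\<Sum>i<l. n i * x i | n. \<forall>i<l. \<bar>n i\<bar> < int (p i)}"

text \<open>
  The condition says exactly that the sums \<open>\<Sum>n\<^sub>l x\<^sub>l\<close> with \<open>0 \<le> n\<^sub>l < p\<^sub>l\<close> are distinct, but in the
  triangular form in which a greedy construction produces it. The next lemma gives the distinctness.
\<close>

definition dissociated :: "(nat \<Rightarrow> int) \<Rightarrow> (nat \<Rightarrow> nat) \<Rightarrow> nat \<Rightarrow> bool" where
  "dissociated x p m \<longleftrightarrow>
     (\<forall>l<m. 0 < p l \<and> (\<forall>b. 0 < b \<and> b < p l \<longrightarrow> int b * x l \<notin> bounded_combinations x p l))"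

lemma bounded_combinations_uminus:
  assumes "z \<in> bounded_combinations x p l"
  shows "- z \<in> bounded_combinations x p l"
proof -
  obtain n where n: "z = (\<Sum>i<l. n i * x i)" "\<forall>i<l. \<bar>n i\<bar> < int (p i)"
    using assms by (auto simp: bounded_combinations_def)
  have "- z = (\<Sum>i<l. (- n i) * x i)" using n(1) by (simp add: sum_negf)
  then show ?thesis using n(2) unfolding bounded_combinations_def
    by (intro CollectI exI[of _ "\<lambda>i. - n i"]) simp
qed

lemma dissociated_box_inj:
  assumes diss: "dissociated x p m"
    and close: "\<And>l. l < m \<Longrightarrow> \<bar>n l - n' l\<bar> < int (p l)"
    and eq: "(\<Sum>l<m. n l * x l) = (\<Sum>l<m. n' l * x l)"
  shows "\<forall>l<m. n l = n' l"
proof (rule ccontr)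
  assume "\<not> ?thesis"
  then have ne: "{l. l < m \<and> n l \<noteq> n' l} \<noteq> {}" by auto
  \<comment> \<open>At the last index where the vectors differ, their difference is a multiple that was excluded.\<close>
  define L where "L = Max {l. l < m \<and> n l \<noteq> n' l}"
  have "L \<in> {l. l < m \<and> n l \<noteq> n' l}" unfolding L_def using ne by (intro Max_in) auto
  then have L: "L < m" "n L \<noteq> n' L" by auto
  have above: "n l = n' l" if "L < l" "l < m" for l
    using that Max_ge[of "{l. l < m \<and> n l \<noteq> n' l}" l] unfolding L_def[symmetric] by force
  have "(\<Sum>l<m. (n l - n' l) * x l) = 0"
    using eq by (simp add: left_diff_distrib sum_subtractf)
  moreover have "(\<Sum>l<m. (n l - n' l) * x l) = (\<Sum>l<Suc L. (n l - n' l) * x l)"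
    using L above by (intro sum.mono_neutral_right) auto
  ultimately have rel: "(n' L - n L) * x L = (\<Sum>l<L. (n l - n' l) * x l)"
    by (simp add: algebra_simps)
  have mem: "(n' L - n L) * x L \<in> bounded_combinations x p L"
    unfolding rel bounded_combinations_def using close L by (auto intro!: exI[of _ "\<lambda>l. n l - n' l"])
  define b where "b = nat \<bar>n' L - n L\<bar>"
  have "int b * x L = (n' L - n L) * x L \<or> int b * x L = - ((n' L - n L) * x L)"
    by (auto simp: b_def abs_if algebra_simps)
  then have "int b * x L \<in> bounded_combinations x p L"
    using mem bounded_combinations_uminus by metis
  moreover have "0 < b" "b < p L" using L close[of L] by (auto simp: b_def)
  ultimately show False using diss L by (auto simp: dissociated_def)
qed

text \<open>
  The left side is the probability that \<open>\<Sum>X\<^sub>l x\<^sub>l = 0\<close> for independent walks \<open>X\<^sub>l\<close> of \<open>N\<close> steps. A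
  solution \<open>n\<close> is determined by the blocks containing its entries, because two solutions in the same
  blocks differ by less than \<open>p\<^sub>l\<close> in each entry. So the sum over solutions is at most a sum over all
  vectors of blocks, which factors.
\<close>

lemma dissociated_return_le:
  assumes "0 \<le> \<nu>" "\<nu> \<le> 1 / 2" and diss: "dissociated x p m"
  shows "(\<Sum>n | n \<in> {..<m} \<rightarrow>\<^sub>E {- int N..int N} \<and> (\<Sum>l<m. n l * x l) = 0. \<Prod>l<m. lazy_walk \<nu> N (n l))
    \<le> (\<Prod>l<m. \<Sum>t\<in>{- int N..int N}. block_bound \<nu> N (p l) t)"
proof -
  let ?A = "{n \<in> {..<m} \<rightarrow>\<^sub>E {- int N..int N}. (\<Sum>l<m. n l * x l) = 0}"
  let ?T = "{..<m} \<rightarrow>\<^sub>E {- int N..int N}"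
  define blk where "blk n = (\<lambda>l\<in>{..<m}. n l div int (p l))" for n :: "nat \<Rightarrow> int"
  have p: "0 < p l" if "l < m" for l using diss that by (auto simp: dissociated_def)
  have nn: "0 \<le> lazy_walk \<nu> N b" for b using assms by (intro lazy_walk_nonneg) auto
  have fin: "finite ?T" by (intro finite_PiE) auto
  have "inj_on blk ?A"
  proof (rule inj_onI)
    fix n n' assume n: "n \<in> ?A" and n': "n' \<in> ?A" and eq: "blk n = blk n'"
    have "\<bar>n l - n' l\<bar> < int (p l)" if "l < m" for l
    proof -
      have q: "n l div int (p l) = n' l div int (p l)"
        using fun_cong[OF eq, of l] that by (simp add: blk_def)
      have "n l - n' l = n l mod int (p l) - n' l mod int (p l)"
        using div_mult_mod_eq[of "n l" "int (p l)"] div_mult_mod_eq[of "n' l" "int (p l)"] unfolding q by linarith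
      moreover have "0 \<le> n l mod int (p l)" "n l mod int (p l) < int (p l)"
        "0 \<le> n' l mod int (p l)" "n' l mod int (p l) < int (p l)"
        using p[OF that] by simp_all
      ultimately show ?thesis by linarith
    qed
    then have "\<forall>l<m. n l = n' l"
      using n n' by (intro dissociated_box_inj[OF diss]) auto
    then show "n = n'" using n n' by (auto intro: PiE_ext)
  qed
  have "blk n \<in> ?T" if "n \<in> ?T" for n
  proof -
    have "n l div int (p l) \<in> {- int N..int N}" if l: "l < m" for l
    proof -
      have nl: "- int N \<le> n l" "n l \<le> int N" using \<open>n \<in> ?T\<close> l by (auto simp: PiE_iff)
      have "\<bar>n l div int (p l)\<bar> \<le> int N"
      proof (cases "0 \<le> n l")
        case True
        have "n l div int (p l) \<le> n l" 
        proof -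
          have "n l * 1 \<le> n l * int (p l)" using True p[OF l] by (intro mult_left_mono) auto
          then show ?thesis using p[OF l] zdiv_mono1[of "n l" "n l * int (p l)" "int (p l)"] by simp
        qed
        moreover have "0 \<le> n l div int (p l)" using True p[OF l] by (simp add: pos_imp_zdiv_nonneg_iff)
        ultimately show ?thesis using nl by linarith
      next
        case False
        have "n l * int (p l) \<le> n l * 1" using False p[OF l] by (intro mult_left_mono_neg) auto
        then have "n l \<le> n l div int (p l)"
          using p[OF l] zdiv_mono1[of "n l * int (p l)" "n l" "int (p l)"] by simp
        moreover have "n l div int (p l) < 0" using False p[OF l] pos_imp_zdiv_neg_iff[of "int (p l)" "n l"] by simp
        ultimately show ?thesis using nl by linarith
      qed
      then show ?thesis by auto
    qed
    then show ?thesis by (auto simp: blk_def)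
  qed
  then have sub: "blk ` ?A \<subseteq> ?T" by auto
  have "(\<Sum>n\<in>?A. \<Prod>l<m. lazy_walk \<nu> N (n l)) \<le> (\<Sum>n\<in>?A. \<Prod>l<m. block_bound \<nu> N (p l) (blk n l))"
    using nn p assms by (intro sum_mono prod_mono) (auto simp: blk_def intro: lazy_walk_le_block_bound)
  also have "\<dots> = (\<Sum>t\<in>blk ` ?A. \<Prod>l<m. block_bound \<nu> N (p l) (t l))"
    using \<open>inj_on blk ?A\<close> by (simp add: sum.reindex)
  also have "\<dots> \<le> (\<Sum>t\<in>?T. \<Prod>l<m. block_bound \<nu> N (p l) (t l))"
    using nn sub fin by (intro sum_mono2 prod_nonneg) (auto simp: block_bound_def)
  also have "\<dots> = (\<Prod>l<m. \<Sum>t\<in>{- int N..int N}. block_bound \<nu> N (p l) t)"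
    by (rule prod_sum_PiE[symmetric]) auto
  finally show ?thesis by simp
qed

section \<open>Fourier expansion over a cyclic group\<close>

text \<open>
  Averages over the \<open>M\<close> frequencies detect divisibility by \<open>M\<close>. With \<open>M\<close> larger than every sum in
  question this amounts to detecting \<open>0\<close>, and all transforms are finite sums.
\<close>

definition freq :: "nat \<Rightarrow> nat \<Rightarrow> real" where
  "freq M j = 2 * pi * real j / real M"

lemma sum_cis_freq:
  assumes "0 < M"
  shows "(\<Sum>j<M. cis (of_int a * freq M j)) = (if int M dvd a then of_nat M else 0)"
proof -
  define z where "z = cis (2 * pi * (of_int a / real M))"
  have "(\<Sum>j<M. cis (of_int a * freq M j)) = (\<Sum>j<M. z ^ j)"
    by (intro sum.cong) (auto simp: z_def Complex.DeMoivre freq_def field_simps)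
  also have "\<dots> = (if int M dvd a then of_nat M else 0)"
  proof (cases "int M dvd a")
    case True
    then obtain c where "a = int M * c" by (elim dvdE)
    then have "z = 1" using assms by (simp add: z_def)
    then show ?thesis using True by simp
  next
    case False
    have "z \<noteq> 1"
    proof
      assume "z = 1"
      then have "cos (2 * pi * (of_int a / real M)) = 1" by (simp add: z_def complex_eq_iff)
      then obtain c where "2 * pi * (of_int a / real M) = of_int c * 2 * pi"
        by (auto simp: cos_one_2pi_int)
      then have "(2 * pi) * (of_int a / real M) = (2 * pi) * of_int c" by (simp only: mult_ac)
      then have "real_of_int a / real M = of_int c" by (subst (asm) mult_left_cancel) auto
      then have "real_of_int a = of_int (c * int M)" using assms by (simp add: field_simps)
      then show False using False by (simp only: of_int_eq_iff) simp
    qed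
    moreover have "z ^ M = 1"
      using assms by (simp add: z_def Complex.DeMoivre)
    ultimately show ?thesis using False by (simp add: sum_gp_strict)
  qed
  finally show ?thesis .
qed

lemma fourier_expansion:
  fixes w :: "int \<Rightarrow> real"
  assumes "0 < M" "finite I" "finite B"
  shows "(\<Sum>j<M. cis (- of_int a * freq M j) *
      (\<Prod>i\<in>I. \<Sum>b\<in>B. w b *\<^sub>R cis (of_int b * (of_int (y i) * freq M j)))) =
    of_nat M * of_real (\<Sum>n | n \<in> I \<rightarrow>\<^sub>E B \<and> int M dvd (\<Sum>i\<in>I. n i * y i) - a. \<Prod>i\<in>I. w (n i))"
proof -
  have cisprod: "(\<Prod>i\<in>I. cis (u i)) = cis (\<Sum>i\<in>I. u i)" for u
    using assms(2) by (induction I rule: finite_induct) (auto simp: cis_mult)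
  have fin: "finite (I \<rightarrow>\<^sub>E B)" using assms by (intro finite_PiE) auto
  have summand: "cis (- of_int a * freq M j) * (\<Prod>i\<in>I. w (n i) *\<^sub>R cis (of_int (n i) * (of_int (y i) * freq M j)))
      = of_real (\<Prod>i\<in>I. w (n i)) * cis (of_int ((\<Sum>i\<in>I. n i * y i) - a) * freq M j)" for j n
  proof -
    have "cis (of_int ((\<Sum>i\<in>I. n i * y i) - a) * freq M j) =
        cis (- of_int a * freq M j) * (\<Prod>i\<in>I. cis (of_int (n i) * (of_int (y i) * freq M j)))"
      by (simp add: cisprod cis_mult algebra_simps sum_distrib_left)
    then show ?thesis by (simp add: scaleR_conv_of_real prod.distrib)
  qed
  have "(\<Sum>j<M. cis (- of_int a * freq M j) *
      (\<Prod>i\<in>I. \<Sum>b\<in>B. w b *\<^sub>R cis (of_int b * (of_int (y i) * freq M j)))) =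
      (\<Sum>j<M. \<Sum>n\<in>I \<rightarrow>\<^sub>E B. of_real (\<Prod>i\<in>I. w (n i)) * cis (of_int ((\<Sum>i\<in>I. n i * y i) - a) * freq M j))"
    using assms by (simp only: prod_sum_PiE sum_distrib_left summand)
  also have "\<dots> = (\<Sum>n\<in>I \<rightarrow>\<^sub>E B. of_real (\<Prod>i\<in>I. w (n i)) * (if int M dvd (\<Sum>i\<in>I. n i * y i) - a then of_nat M else 0))"
    by (subst sum.swap) (simp add: sum_distrib_left[symmetric] sum_cis_freq[OF assms(1)] del: of_int_diff of_int_sum of_real_prod)
  also have "\<dots> = of_nat M * (\<Sum>n\<in>I \<rightarrow>\<^sub>E B. if int M dvd (\<Sum>i\<in>I. n i * y i) - a then of_real (\<Prod>i\<in>I. w (n i)) else 0)"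
    by (simp add: sum_distrib_left if_distrib mult.commute cong: if_cong)
  also have "\<dots> = of_nat M * of_real (\<Sum>n | n \<in> I \<rightarrow>\<^sub>E B \<and> int M dvd (\<Sum>i\<in>I. n i * y i) - a. \<Prod>i\<in>I. w (n i))"
    using fin by (simp add: sum.inter_filter[symmetric])
  finally show ?thesis .
qed

text \<open>
  The law of the walk as a finite sum of products, in the shape in which \<open>fourier_expansion\<close> produces it.
\<close>

lemma pmf_walk_pmf:
  "pmf (walk_pmf \<mu> v) a = (\<Sum>n | n \<in> {..<length v} \<rightarrow>\<^sub>E {-1, 0, 1} \<and> (\<Sum>i<length v. n i * v ! i) = a.
     \<Prod>i<length v. pmf (eta_pmf \<mu>) (n i))"
proof -
  let ?I = "{..<length v}"
  let ?P = "Pi_pmf ?I 0 (\<lambda>_. eta_pmf \<mu>)"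
  let ?A = "{n \<in> ?I \<rightarrow>\<^sub>E {-1, 0, 1}. (\<Sum>i<length v. n i * v ! i) = a}"
  define ext where "ext n = (\<lambda>i. if i \<in> ?I then n i else 0)" for n :: "nat \<Rightarrow> int"
  have inj: "inj_on ext ?A"
  proof (rule inj_onI)
    fix n n' assume n: "n \<in> ?A" "n' \<in> ?A" and eq: "ext n = ext n'"
    have "n i = n' i" if "i \<in> ?I" for i using fun_cong[OF eq, of i] that by (simp add: ext_def)
    then show "n = n'" using n by (auto intro: PiE_ext)
  qed
  have "finite (?I \<rightarrow>\<^sub>E {-1, 0, 1 :: int})" by (intro finite_PiE) auto
  then have fin: "finite ?A" by (rule rev_finite_subset) blast
  have "pmf (walk_pmf \<mu> v) a = measure ?P {\<eta>. (\<Sum>i<length v. \<eta> i * v ! i) = a}"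
    by (simp add: walk_pmf_def pmf_map vimage_def)
  also have "\<dots> = measure ?P (ext ` ?A)"
  proof (rule measure_eq_AE)
    show "AE \<eta> in ?P. (\<eta> \<in> {\<eta>. (\<Sum>i<length v. \<eta> i * v ! i) = a}) = (\<eta> \<in> ext ` ?A)"
    proof (rule AE_pmfI)
      fix \<eta> assume "\<eta> \<in> set_pmf ?P"
      then have val: "\<eta> i \<in> {-1, 0, 1}" if "i \<in> ?I" for i
        using set_pmf_eta_pmf that by (auto simp: set_Pi_pmf PiE_dflt_def)
      have out: "\<eta> i = 0" if "i \<notin> ?I" for i
        using \<open>\<eta> \<in> set_pmf ?P\<close> that by (auto simp: set_Pi_pmf PiE_dflt_def)
      have "\<eta> \<in> ext ` ?A" if "(\<Sum>i<length v. \<eta> i * v ! i) = a"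
      proof
        show "\<eta> = ext (restrict \<eta> ?I)" using out by (auto simp: ext_def)
        show "restrict \<eta> ?I \<in> ?A" using that val by auto
      qed
      moreover have "(\<Sum>i<length v. \<eta> i * v ! i) = a" if img: "\<eta> \<in> ext ` ?A"
      proof -
        obtain n where n: "\<eta> = ext n" "n \<in> ?A" using img by (rule imageE)
        have "(\<Sum>i<length v. \<eta> i * v ! i) = (\<Sum>i<length v. n i * v ! i)"
          by (intro sum.cong refl) (simp add: n(1) ext_def)
        then show ?thesis using n(2) by simp
      qed
      ultimately show "(\<eta> \<in> {\<eta>. (\<Sum>i<length v. \<eta> i * v ! i) = a}) = (\<eta> \<in> ext ` ?A)" by blast
    qed
  qed auto
  also have "\<dots> = (\<Sum>\<eta>\<in>ext ` ?A. pmf ?P \<eta>)"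
    using fin by (intro measure_measure_pmf_finite) auto
  also have "\<dots> = (\<Sum>n\<in>?A. pmf ?P (ext n))"
    using inj by (simp add: sum.reindex)
  also have "\<dots> = (\<Sum>n\<in>?A. \<Prod>i<length v. pmf (eta_pmf \<mu>) (n i))"
    by (intro sum.cong refl, subst pmf_Pi') (auto simp: ext_def)
  finally show ?thesis by simp
qed

definition lazy_char :: "real \<Rightarrow> real \<Rightarrow> real" where
  "lazy_char \<nu> \<theta> = 1 - \<nu> + \<nu> * cos \<theta>"

text \<open>
  Passing from \<open>\<mu>\<close> to \<open>\<mu> / 4\<close> and doubling the frequency makes the characteristic function positive
  without decreasing its modulus. With \<open>c = cos \<theta>\<close> the two differences are \<open>\<mu> (1 - c)\<^sup>2 / 2\<close> and
  \<open>2 (1 - \<mu>) + \<mu> (1 + c)\<^sup>2 / 2\<close>.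
\<close>

lemma abs_lazy_char_le:
  assumes "0 \<le> \<mu>" "\<mu> \<le> 1"
  shows "\<bar>lazy_char \<mu> \<theta>\<bar> \<le> lazy_char (\<mu> / 4) (2 * \<theta>)"
proof -
  define c where "c = cos \<theta>"
  have c: "-1 \<le> c" "c \<le> 1" by (auto simp: c_def)
  have rhs: "lazy_char (\<mu> / 4) (2 * \<theta>) = 1 - \<mu> / 2 * (1 - c\<^sup>2)"
  proof -
    have double: "cos (2 * \<theta>) = 2 * c\<^sup>2 - 1" by (simp add: cos_double_cos c_def)
    then show ?thesis unfolding lazy_char_def double by (simp add: field_simps)
  qed
  have "0 \<le> \<mu> / 2 * (1 - c)\<^sup>2" using assms by simp
  also have "\<dots> = 1 - \<mu> / 2 * (1 - c\<^sup>2) - (1 - \<mu> + \<mu> * c)"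
    by (simp add: power2_eq_square field_simps)
  finally have 1: "1 - \<mu> + \<mu> * c \<le> 1 - \<mu> / 2 * (1 - c\<^sup>2)" by (simp only: diff_ge_0_iff_ge)
  have "0 \<le> 2 * (1 - \<mu>) + \<mu> / 2 * (1 + c)\<^sup>2" using assms by simp
  also have "\<dots> = 1 - \<mu> / 2 * (1 - c\<^sup>2) - (- (1 - \<mu> + \<mu> * c))"
    by (simp add: power2_eq_square field_simps)
  finally have "- (1 - \<mu> + \<mu> * c) \<le> 1 - \<mu> / 2 * (1 - c\<^sup>2)" by (simp only: diff_ge_0_iff_ge)
  with 1 show ?thesis unfolding rhs by (simp only: lazy_char_def c_def[symmetric] abs_le_iff)
qed

lemma pmf_walk_pmf_le:
  assumes "0 \<le> \<mu>" "\<mu> \<le> 1" "0 < M"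
  shows "pmf (walk_pmf \<mu> v) a \<le>
    (\<Sum>j<M. \<Prod>i<length v. lazy_char (\<mu> / 4) (2 * (of_int (v ! i) * freq M j))) / M"
proof -
  let ?I = "{..<length v}"
  let ?w = "pmf (eta_pmf \<mu>)"
  let ?R = "\<Sum>n | n \<in> ?I \<rightarrow>\<^sub>E {-1, 0, 1} \<and> int M dvd (\<Sum>i<length v. n i * v ! i) - a. \<Prod>i<length v. ?w (n i)"
  have char: "(\<Sum>b\<in>{-1, 0, 1}. ?w b *\<^sub>R cis (of_int b * \<theta>)) = of_real (lazy_char \<mu> \<theta>)" for \<theta>
    using assms by (simp add: pmf_eta_pmf lazy_char_def complex_eq_iff field_simps)
  have fin: "finite (?I \<rightarrow>\<^sub>E {-1, 0, 1 :: int})" by (intro finite_PiE) auto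
  have "pmf (walk_pmf \<mu> v) a \<le> ?R"
    unfolding pmf_walk_pmf
  proof (rule sum_mono2)
    show "finite {n \<in> ?I \<rightarrow>\<^sub>E {-1, 0, 1}. int M dvd (\<Sum>i<length v. n i * v ! i) - a}"
      using fin by (rule rev_finite_subset) blast
    show "{n \<in> ?I \<rightarrow>\<^sub>E {-1, 0, 1}. (\<Sum>i<length v. n i * v ! i) = a}
        \<subseteq> {n \<in> ?I \<rightarrow>\<^sub>E {-1, 0, 1}. int M dvd (\<Sum>i<length v. n i * v ! i) - a}"
      by (intro Collect_mono) simp
  qed (simp add: prod_nonneg)
  then have "M * pmf (walk_pmf \<mu> v) a \<le> M * ?R" using assms by simp
  also have "\<dots> = norm (of_nat M * complex_of_real ?R)"
  proof -
    have "0 \<le> ?R" by (intro sum_nonneg prod_nonneg) simp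
    then show ?thesis by (simp only: norm_mult norm_of_nat norm_of_real abs_of_nonneg)
  qed
  also have "of_nat M * complex_of_real ?R =
      (\<Sum>j<M. cis (- of_int a * freq M j) * (\<Prod>i<length v. of_real (lazy_char \<mu> (of_int (v ! i) * freq M j))))"
    using fourier_expansion[OF assms(3), of ?I "{-1, 0, 1}" a ?w "\<lambda>i. v ! i", symmetric]
    by (simp only: char finite_lessThan finite.intros)
  also have "norm \<dots> \<le> (\<Sum>j<M. norm (cis (- of_int a * freq M j) * (\<Prod>i<length v. of_real (lazy_char \<mu> (of_int (v ! i) * freq M j)))))"
    by (rule norm_sum)
  also have "\<dots> = (\<Sum>j<M. \<Prod>i<length v. \<bar>lazy_char \<mu> (of_int (v ! i) * freq M j)\<bar>)"
    by (simp only: norm_mult norm_cis prod_norm[symmetric] norm_of_real mult_1_left)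
  also have "\<dots> \<le> (\<Sum>j<M. \<Prod>i<length v. lazy_char (\<mu> / 4) (2 * (of_int (v ! i) * freq M j)))"
    using assms by (intro sum_mono prod_mono) (auto intro: abs_lazy_char_le)
  finally show ?thesis using assms(3) by (simp add: pos_le_divide_eq mult.commute)
qed

text \<open>
  The frequencies are doubled as in \<open>abs_lazy_char_le\<close>, so the mean detects \<open>M dvd 2 \<Sum>n\<^sub>l x\<^sub>l\<close>; since
  \<open>M\<close> is odd and exceeds all these sums, this means \<open>\<Sum>n\<^sub>l x\<^sub>l = 0\<close>.
\<close>

lemma mean_lazy_char_le:
  assumes "0 \<le> \<nu>" "\<nu> \<le> 1 / 2" "dissociated x p m" "odd M" "int N * (\<Sum>l<m. \<bar>x l\<bar>) < int M"
  shows "(\<Sum>j<M. \<Prod>l<m. lazy_char \<nu> (2 * (of_int (x l) * freq M j)) ^ N) / M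
    \<le> (\<Prod>l<m. \<Sum>t\<in>{- int N..int N}. block_bound \<nu> N (p l) t)"
proof -
  let ?T = "{..<m} \<rightarrow>\<^sub>E {- int N..int N}"
  have M: "0 < M" using assms(4) by (simp add: odd_pos)
  have iff: "int M dvd (\<Sum>l<m. n l * (2 * x l)) - 0 \<longleftrightarrow> (\<Sum>l<m. n l * x l) = 0" if "n \<in> ?T" for n
  proof
    assume "int M dvd (\<Sum>l<m. n l * (2 * x l)) - 0"
    moreover have "(\<Sum>l<m. n l * (2 * x l)) = 2 * (\<Sum>l<m. n l * x l)"
      by (simp add: sum_distrib_left algebra_simps)
    moreover have "coprime (int M) 2" using assms(4) by simp
    ultimately have "int M dvd (\<Sum>l<m. n l * x l)"
      by (simp add: coprime_dvd_mult_right_iff)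
    moreover have "\<bar>\<Sum>l<m. n l * x l\<bar> < int M"
    proof -
      have "\<bar>\<Sum>l<m. n l * x l\<bar> \<le> (\<Sum>l<m. \<bar>n l\<bar> * \<bar>x l\<bar>)"
        using sum_abs[of "\<lambda>l. n l * x l" "{..<m}"] by (simp add: abs_mult)
      also have "\<dots> \<le> (\<Sum>l<m. int N * \<bar>x l\<bar>)"
      proof (intro sum_mono mult_right_mono)
        fix l assume "l \<in> {..<m}"
        then have "n l \<in> {- int N..int N}" using that by (auto simp: PiE_iff)
        then show "\<bar>n l\<bar> \<le> int N" by auto
      qed auto
      finally show ?thesis using assms(5) by (simp add: sum_distrib_left)
    qed
    ultimately show "(\<Sum>l<m. n l * x l) = 0"
      by (metis abs_of_nat dvd_imp_le_int linorder_not_less)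
  next
    assume "(\<Sum>l<m. n l * x l) = 0"
    moreover have "(\<Sum>l<m. n l * (2 * x l)) = 2 * (\<Sum>l<m. n l * x l)"
      by (simp add: sum_distrib_left algebra_simps)
    ultimately show "int M dvd (\<Sum>l<m. n l * (2 * x l)) - 0" by simp
  qed
  have "of_real (\<Sum>j<M. \<Prod>l<m. lazy_char \<nu> (2 * (of_int (x l) * freq M j)) ^ N) =
      (\<Sum>j<M. cis (- of_int 0 * freq M j) * (\<Prod>l<m. \<Sum>b\<in>{- int N..int N}. lazy_walk \<nu> N b *\<^sub>R cis (of_int b * (of_int (2 * x l) * freq M j))))"
    by (simp add: sum_lazy_walk_cis lazy_char_def mult.assoc)
  also have "\<dots> = of_nat M * of_real (\<Sum>n | n \<in> ?T \<and> int M dvd (\<Sum>l<m. n l * (2 * x l)) - 0. \<Prod>l<m. lazy_walk \<nu> N (n l))"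
    using M by (intro fourier_expansion) auto
  also have "{n. n \<in> ?T \<and> int M dvd (\<Sum>l<m. n l * (2 * x l)) - 0} = {n. n \<in> ?T \<and> (\<Sum>l<m. n l * x l) = 0}"
    using iff by blast
  finally have "complex_of_real (\<Sum>j<M. \<Prod>l<m. lazy_char \<nu> (2 * (of_int (x l) * freq M j)) ^ N) =
    of_real (real M * (\<Sum>n | n \<in> ?T \<and> (\<Sum>l<m. n l * x l) = 0. \<Prod>l<m. lazy_walk \<nu> N (n l)))"
    by simp
  then have "(\<Sum>j<M. \<Prod>l<m. lazy_char \<nu> (2 * (of_int (x l) * freq M j)) ^ N) =
    real M * (\<Sum>n | n \<in> ?T \<and> (\<Sum>l<m. n l * x l) = 0. \<Prod>l<m. lazy_walk \<nu> N (n l))"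
    by (simp only: of_real_eq_iff)
  then show ?thesis
    using M dissociated_return_le[OF assms(1-3), of N] by simp
qed


section \<open>Replacing many factors by powers of one\<close>

text \<open>
  The inequality between the arithmetic and the geometric mean of the \<open>f i ^ N\<close>, obtained by summing
  \<open>1 + ln u \<le> u\<close> over the quotients \<open>u = f i ^ N / G\<close>, whose product is \<open>1\<close>.
\<close>

lemma prod_le_mean_power:
  fixes f :: "'i \<Rightarrow> real"
  assumes "finite W" "card W = N" "\<And>i. i \<in> W \<Longrightarrow> 0 < f i"
  shows "real N * (\<Prod>i\<in>W. f i) \<le> (\<Sum>i\<in>W. f i ^ N)"
proof -
  define G where "G = (\<Prod>i\<in>W. f i)"
  have G: "0 < G" unfolding G_def using assms(3) by (rule prod_pos)
  have "real N = (\<Sum>i\<in>W. 1 + ln (f i ^ N / G))"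
  proof -
    have "(\<Sum>i\<in>W. 1 + ln (f i ^ N / G)) = (\<Sum>i\<in>W. 1 + (real N * ln (f i) - ln G))"
    proof (intro sum.cong refl)
      fix i assume "i \<in> W"
      then have "0 < f i" using assms(3) by simp
      then show "1 + ln (f i ^ N / G) = 1 + (real N * ln (f i) - ln G)"
        using G by (simp add: ln_div ln_realpow)
    qed
    also have "\<dots> = real N + real N * (\<Sum>i\<in>W. ln (f i)) - real N * ln G"
      using assms(2) by (simp add: sum.distrib sum_subtractf sum_distrib_left)
    also have "(\<Sum>i\<in>W. ln (f i)) = ln G"
      unfolding G_def by (intro ln_prod[symmetric]) (use assms in force)+
    finally show ?thesis by simp
  qed
  also have "\<dots> \<le> (\<Sum>i\<in>W. f i ^ N / G)"
  proof (intro sum_mono)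
    fix i assume "i \<in> W"
    then have "0 < f i ^ N / G" using assms(3) G by simp
    then show "1 + ln (f i ^ N / G) \<le> f i ^ N / G" using ln_le_minus_one by force
  qed
  finally show ?thesis using G by (simp add: sum_divide_distrib[symmetric] pos_le_divide_eq flip: G_def)
qed

text \<open>
  This takes the place of Hoelder's inequality: averaging the pointwise bound over \<open>i\<close> shows that
  for some \<open>i\<close> passing from the product to the \<open>N\<close>-th power does not decrease the weighted sum. The weight \<open>g\<close> collects all the other factors.
\<close>

lemma exists_factor_repeated:
  fixes f :: "'i \<Rightarrow> 'j \<Rightarrow> real"
  assumes "finite W" "card W = N" "0 < N" "\<And>i j. i \<in> W \<Longrightarrow> 0 < f i j" "\<And>j. 0 \<le> g j"
  shows "\<exists>i\<in>W. (\<Sum>j\<in>J. g j * (\<Prod>i\<in>W. f i j)) \<le> (\<Sum>j\<in>J. g j * f i j ^ N)"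
proof (rule ccontr)
  assume "\<not> ?thesis"
  then have less: "(\<Sum>j\<in>J. g j * f i j ^ N) < (\<Sum>j\<in>J. g j * (\<Prod>i\<in>W. f i j))" if "i \<in> W" for i
    using that by force
  have "W \<noteq> {}" using assms by auto
  then have "(\<Sum>i\<in>W. \<Sum>j\<in>J. g j * f i j ^ N) < (\<Sum>i\<in>W. \<Sum>j\<in>J. g j * (\<Prod>i\<in>W. f i j))"
    by (intro sum_strict_mono less) (use assms(1) \<open>W \<noteq> {}\<close> in blast)+
  also have "\<dots> = (\<Sum>j\<in>J. g j * (real N * (\<Prod>i\<in>W. f i j)))"
    using assms(2) by (simp add: sum_distrib_left mult_ac)
  also have "\<dots> \<le> (\<Sum>j\<in>J. g j * (\<Sum>i\<in>W. f i j ^ N))"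
    using assms by (intro sum_mono mult_left_mono prod_le_mean_power) auto
  also have "\<dots> = (\<Sum>i\<in>W. \<Sum>j\<in>J. g j * f i j ^ N)"
    by (subst sum.swap) (simp add: sum_distrib_left)
  finally show False by simp
qed

section \<open>Greedy construction of a dissociated sequence\<close>

text \<open>
  The last alternative records why \<open>p l\<close> was not chosen larger: either it has reached the cap \<open>k\<close>, or
  \<open>p l\<close> times \<open>x l\<close> is a combination of the earlier terms.
\<close>

definition dissociated_chain :: "nat \<Rightarrow> nat \<Rightarrow> (nat \<Rightarrow> int) \<Rightarrow> (nat \<Rightarrow> nat) \<Rightarrow> nat \<Rightarrow> bool" where
  "dissociated_chain T k x p m \<longleftrightarrow> dissociated x p m \<and>
     (\<forall>l<m. T < p l \<and> p l \<le> k \<and> (p l = k \<or> int (p l) * x l \<in> bounded_combinations x p l))"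

text \<open>
  Allowing multipliers up to \<open>T\<close>, and not only \<open>b = 1\<close>, forces \<open>p l > T\<close> at every step of the
  construction. This bounds its length by \<open>O(log k / log T)\<close>, at the cost of denominators dividing \<open>T!\<close>.
\<close>

definition captured :: "nat \<Rightarrow> (nat \<Rightarrow> int) \<Rightarrow> (nat \<Rightarrow> nat) \<Rightarrow> nat \<Rightarrow> int \<Rightarrow> bool" where
  "captured T x p m y \<longleftrightarrow> (\<exists>b. 0 < b \<and> b \<le> T \<and> int b * y \<in> bounded_combinations x p m)"

lemma bounded_combinations_cong:
  assumes "\<And>i. i < l \<Longrightarrow> x i = x' i" "\<And>i. i < l \<Longrightarrow> p i = p' i"
  shows "bounded_combinations x p l = bounded_combinations x' p' l"
proof -
  have "(\<Sum>i<l. n i * x i) = (\<Sum>i<l. n i * x' i)" for n :: "nat \<Rightarrow> int"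
    using assms(1) by (intro sum.cong) auto
  then show ?thesis using assms(2) unfolding bounded_combinations_def by auto
qed

lemma dissociated_chain_extend:
  assumes chain: "dissociated_chain T k x p m" and "T < k" and out: "\<not> captured T x p m y"
  shows "\<exists>q. dissociated_chain T k (x(m := y)) (p(m := q)) (Suc m)"
proof -
  let ?B = "bounded_combinations x p m"
  obtain q where q: "T < q" "q \<le> k" "\<And>b. 0 < b \<Longrightarrow> b < q \<Longrightarrow> int b * y \<notin> ?B" "q = k \<or> int q * y \<in> ?B"
  proof (cases "\<exists>b. 0 < b \<and> b < k \<and> int b * y \<in> ?B")
    case True
    define R where "R b \<longleftrightarrow> 0 < b \<and> int b * y \<in> ?B" for b
    define q where "q = (LEAST b. R b)"
    obtain b where b: "R b" "b < k" using True by (auto simp: R_def)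
    have qB: "R q" unfolding q_def using b(1) by (rule LeastI)
    have le: "q \<le> c" if "R c" for c unfolding q_def using that by (rule Least_le)
    show ?thesis
    proof (rule that[of q])
      show "T < q"
      proof (rule ccontr)
        assume "\<not> T < q"
        then have "captured T x p m y" unfolding captured_def using qB by (intro exI[of _ q]) (simp add: R_def)
        then show False using out by simp
      qed
      show "q \<le> k" using le[OF b(1)] b(2) by simp
      show "int c * y \<notin> ?B" if "0 < c" "c < q" for c using le[of c] that by (auto simp: R_def)
      show "q = k \<or> int q * y \<in> ?B" using qB by (simp add: R_def)
    qed
  next
    case False
    then show ?thesis using \<open>T < k\<close> by (intro that[of k]) auto
  qed
  have B: "bounded_combinations (x(m := y)) (p(m := q)) l = bounded_combinations x p l" if "l \<le> m" for l
    using that by (intro bounded_combinations_cong) auto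
  have "dissociated_chain T k (x(m := y)) (p(m := q)) (Suc m)"
    using chain q unfolding dissociated_chain_def dissociated_def
    by (auto simp: less_Suc_eq B)
  then show ?thesis ..
qed

lemma lazy_char_bounds:
  assumes "0 \<le> \<nu>" "\<nu> < 1 / 2"
  shows "0 < lazy_char \<nu> \<theta>" "lazy_char \<nu> \<theta> \<le> 1"
proof -
  have "\<nu> * (1 - cos \<theta>) \<le> \<nu> * 2" "0 \<le> \<nu> * (1 - cos \<theta>)"
    using assms cos_ge_minus_one[of \<theta>] by (auto intro!: mult_left_mono mult_nonneg_nonneg)
  then show "0 < lazy_char \<nu> \<theta>" "lazy_char \<nu> \<theta> \<le> 1"
    using assms by (simp_all add: lazy_char_def algebra_simps)
qed

text \<open>
  \<open>U\<close> is the set of positions of \<open>v\<close> that have not been used. If \<open>N\<close> of these hold elements that are not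
  captured, their factors are replaced by the \<open>N\<close>-th power of one of them, and the corresponding element
  extends the chain. Each step uses up \<open>N\<close> positions, so there is a chain of maximal length, and for it
  fewer than \<open>N\<close> of the unused elements are not captured.
\<close>

lemma exists_maximal_chain:
  fixes v :: "int list" and h :: "int \<Rightarrow> nat \<Rightarrow> real"
  assumes "T < k" "0 < N" and h: "\<And>y j. 0 < h y j" "\<And>y j. h y j \<le> 1"
  obtains x p m where "dissociated_chain T k x p m" "\<And>l. l < m \<Longrightarrow> x l \<in> set v" "m * N \<le> length v"
    "(\<Sum>j\<in>J. \<Prod>i<length v. h (v ! i) j) \<le> (\<Sum>j\<in>J. \<Prod>l<m. h (x l) j ^ N)"
    "length (filter (\<lambda>y. \<not> captured T x p m y) v) < (m + 1) * N"
proof -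
  let ?n = "length v"
  define P where "P m x p U \<longleftrightarrow> dissociated_chain T k x p m \<and> (\<forall>l<m. x l \<in> set v) \<and> U \<subseteq> {..<?n} \<and>
    card U + m * N = ?n \<and>
    (\<Sum>j\<in>J. \<Prod>i<?n. h (v ! i) j) \<le> (\<Sum>j\<in>J. (\<Prod>l<m. h (x l) j ^ N) * (\<Prod>i\<in>U. h (v ! i) j))" for m x p U
  define S where "S = {m. \<exists>x p U. P m x p U}"
  have "P 0 (\<lambda>_. 0) (\<lambda>_. 0) {..<?n}"
    by (simp add: P_def dissociated_chain_def dissociated_def)
  then have "0 \<in> S" unfolding S_def by blast
  have "S \<subseteq> {..?n}"
  proof
    fix m assume "m \<in> S"
    then have "m * N \<le> ?n" by (force simp: S_def P_def)
    moreover have "m * 1 \<le> m * N" using \<open>0 < N\<close> by (intro mult_le_mono2) simp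
    ultimately have "m \<le> ?n" by linarith
    then show "m \<in> {..?n}" by simp
  qed
  then have fin: "finite S" by (rule finite_subset) simp
  define m where "m = Max S"
  have "m \<in> S" unfolding m_def using fin \<open>0 \<in> S\<close> by (intro Max_in) auto
  then obtain x p U where P: "P m x p U" by (auto simp: S_def)
  have "Suc m \<notin> S"
  proof
    assume "Suc m \<in> S"
    from Max_ge[OF fin this] show False by (simp add: m_def)
  qed
  have finU: "finite U" using P by (auto simp: P_def intro: finite_subset)
  have few: "card {i \<in> U. \<not> captured T x p m (v ! i)} < N"
  proof (rule ccontr)
    assume "\<not> ?thesis"
    then obtain W where W: "W \<subseteq> {i \<in> U. \<not> captured T x p m (v ! i)}" "card W = N" "finite W"
      using obtain_subset_with_card_n[of N "{i \<in> U. \<not> captured T x p m (v ! i)}"] by (auto simp: not_less)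
    define g where "g j = (\<Prod>l<m. h (x l) j ^ N) * (\<Prod>i\<in>U - W. h (v ! i) j)" for j
    have "\<exists>i\<in>W. (\<Sum>j\<in>J. g j * (\<Prod>i\<in>W. h (v ! i) j)) \<le> (\<Sum>j\<in>J. g j * h (v ! i) j ^ N)"
      using W \<open>0 < N\<close> h(1) by (intro exists_factor_repeated) (auto simp: g_def less_imp_le intro!: mult_nonneg_nonneg prod_nonneg)
    then obtain i where i: "i \<in> W" "(\<Sum>j\<in>J. g j * (\<Prod>i\<in>W. h (v ! i) j)) \<le> (\<Sum>j\<in>J. g j * h (v ! i) j ^ N)"
      by blast
    have iU: "i \<in> U" "i < ?n" "\<not> captured T x p m (v ! i)"
      using i W P by (auto simp: P_def)
    obtain q where q: "dissociated_chain T k (x(m := v ! i)) (p(m := q)) (Suc m)"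
      using dissociated_chain_extend[of T k x p m "v ! i"] P iU \<open>T < k\<close> by (auto simp: P_def)
    have split: "(\<Prod>i\<in>U. h (v ! i) j) = (\<Prod>i\<in>U - W. h (v ! i) j) * (\<Prod>i\<in>W. h (v ! i) j)" for j
      using W finU by (intro prod.subset_diff) auto
    have upd: "(\<Prod>l<m. h ((x(m := v ! i)) l) j ^ N) = (\<Prod>l<m. h (x l) j ^ N)" for j
      by (intro prod.cong) auto
    have "P (Suc m) (x(m := v ! i)) (p(m := q)) (U - W)"
      unfolding P_def
    proof (intro conjI)
      show "card (U - W) + Suc m * N = ?n"
        using W finU P card_mono[of U W] by (auto simp: P_def card_Diff_subset subset_iff)
      show "(\<Sum>j\<in>J. \<Prod>i<?n. h (v ! i) j) \<le>
          (\<Sum>j\<in>J. (\<Prod>l<Suc m. h ((x(m := v ! i)) l) j ^ N) * (\<Prod>i\<in>U - W. h (v ! i) j))"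
        using P i(2) by (auto simp: P_def g_def split upd mult_ac)
    qed (use q P iU in \<open>auto simp: P_def less_Suc_eq\<close>)
    then show False using \<open>Suc m \<notin> S\<close> by (auto simp: S_def)
  qed
  show ?thesis
  proof (rule that[of x p m])
    have "(\<Sum>j\<in>J. (\<Prod>l<m. h (x l) j ^ N) * (\<Prod>i\<in>U. h (v ! i) j)) \<le> (\<Sum>j\<in>J. (\<Prod>l<m. h (x l) j ^ N) * 1)"
      using h by (intro sum_mono mult_left_mono prod_le_1 prod_nonneg) (auto simp: less_imp_le)
    then show "(\<Sum>j\<in>J. \<Prod>i<?n. h (v ! i) j) \<le> (\<Sum>j\<in>J. \<Prod>l<m. h (x l) j ^ N)"
      using P by (simp add: P_def)
    have "length (filter (\<lambda>y. \<not> captured T x p m y) v) = card {i. i < ?n \<and> \<not> captured T x p m (v ! i)}"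
      by (rule length_filter_conv_card)
    also have "\<dots> \<le> card ({i \<in> U. \<not> captured T x p m (v ! i)} \<union> ({..<?n} - U))"
      using finU by (intro card_mono) auto
    also have "\<dots> \<le> card {i \<in> U. \<not> captured T x p m (v ! i)} + card ({..<?n} - U)"
      by (rule card_Un_le)
    also have "card ({..<?n} - U) = m * N"
      using P finU by (auto simp: P_def card_Diff_subset)
    finally show "length (filter (\<lambda>y. \<not> captured T x p m y) v) < (m + 1) * N"
      using few by simp
    show "dissociated_chain T k x p m" using P by (simp add: P_def)
    show "x l \<in> set v" if "l < m" for l using P that by (simp add: P_def)
    show "m * N \<le> ?n" using P unfolding P_def by linarith
  qed
qed

text \<open>
  With \<open>N = k\<^sup>2\<close> steps the point masses of the walk are \<open>O(1 / k)\<close>, which is \<open>O(1 / p)\<close> for every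
  \<open>p \<le> k\<close>. This is where the cap on \<open>p\<close> comes from.
\<close>

lemma chain_extraction:
  fixes v :: "int list"
  assumes "0 < \<mu>" "\<mu> \<le> 1" "T < k"
  obtains x p m where "dissociated_chain T k x p m" "\<And>l. l < m \<Longrightarrow> x l \<in> set v"
    "max_prob \<mu> v \<le> (\<Prod>l<m. (4 / sqrt \<mu> + 2) / real (p l))"
    "length (filter (\<lambda>y. \<not> captured T x p m y) v) < (m + 1) * k\<^sup>2"
proof -
  define \<nu> where "\<nu> = \<mu> / 4"
  have \<nu>: "0 < \<nu>" "\<nu> < 1 / 2" using assms by (auto simp: \<nu>_def)
  define N where "N = k\<^sup>2"
  have "0 < N" using assms by (simp add: N_def)
  define A where "A = (\<Sum>y\<in>set v. \<bar>y\<bar>)"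
  have A: "\<bar>y\<bar> \<le> A" if "y \<in> set v" for y
    unfolding A_def using that by (intro member_le_sum) auto
  have "0 \<le> A" unfolding A_def by (rule sum_nonneg) simp
  \<comment> \<open>The chain depends on the modulus, so \<open>M\<close> has to beat a bound valid for every chain in \<open>v\<close>.\<close>
  define M where "M = 2 * nat (int N * (int (length v) * A)) + 1"
  define h where "h y j = lazy_char \<nu> (2 * (of_int y * freq M j))" for y j
  obtain x p m where c: "dissociated_chain T k x p m" "\<And>l. l < m \<Longrightarrow> x l \<in> set v" "m * N \<le> length v"
    "(\<Sum>j\<in>{..<M}. \<Prod>i<length v. h (v ! i) j) \<le> (\<Sum>j\<in>{..<M}. \<Prod>l<m. h (x l) j ^ N)"
    "length (filter (\<lambda>y. \<not> captured T x p m y) v) < (m + 1) * N"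
    using exists_maximal_chain[OF assms(3) \<open>0 < N\<close>, of h v "{..<M}"] lazy_char_bounds[of \<nu>] \<nu>
    unfolding h_def by (metis less_imp_le)
  have "odd M" "0 < M" by (auto simp: M_def)
  have diss: "dissociated x p m" using c(1) by (simp add: dissociated_chain_def)
  have "(\<Sum>l<m. \<bar>x l\<bar>) \<le> (\<Sum>l<m. A)" using A c(2) by (intro sum_mono) auto
  also have "\<dots> \<le> int (length v) * A"
  proof -
    have "m * 1 \<le> m * N" using \<open>0 < N\<close> by (intro mult_le_mono2) simp
    then have "m \<le> length v" using c(3) by linarith
    then show ?thesis using \<open>0 \<le> A\<close> by (simp add: mult_right_mono)
  qed
  finally have "int N * (\<Sum>l<m. \<bar>x l\<bar>) \<le> int N * (int (length v) * A)" by (intro mult_left_mono) auto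
  moreover have "0 \<le> int N * (int (length v) * A)" using \<open>0 \<le> A\<close> by simp
  ultimately have big: "int N * (\<Sum>l<m. \<bar>x l\<bar>) < int M"
    unfolding M_def by simp
  have factor: "(\<Sum>t\<in>{- int N..int N}. block_bound \<nu> N (p l) t) \<le> (4 / sqrt \<mu> + 2) / real (p l)" if "l < m" for l
  proof -
    have p: "0 < p l" "p l \<le> k" using c(1) that by (auto simp: dissociated_chain_def)
    have "(\<Sum>t\<in>{- int N..int N}. block_bound \<nu> N (p l) t) \<le> 2 * lazy_walk \<nu> N 0 + 2 / p l"
      using \<nu> p by (intro sum_block_bound_le) auto
    also have "lazy_walk \<nu> N 0 \<le> 1 / sqrt (\<nu> * N)"
      using \<nu> \<open>0 < N\<close> by (intro lazy_walk_at_zero_le) auto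
    also have "sqrt (\<nu> * N) = sqrt \<mu> / 2 * k"
      by (simp add: \<nu>_def N_def real_sqrt_mult real_sqrt_divide)
    also have "1 / (sqrt \<mu> / 2 * k) \<le> 1 / (sqrt \<mu> / 2 * p l)"
      using assms p by (intro divide_left_mono mult_left_mono mult_pos_pos) auto
    finally show ?thesis by (simp add: add_divide_distrib add.commute)
  qed
  have "pmf (walk_pmf \<mu> v) a \<le> (\<Prod>l<m. (4 / sqrt \<mu> + 2) / real (p l))" for a
  proof -
    have "pmf (walk_pmf \<mu> v) a \<le> (\<Sum>j<M. \<Prod>i<length v. h (v ! i) j) / M"
      unfolding h_def \<nu>_def using assms \<open>0 < M\<close> by (intro pmf_walk_pmf_le) auto
    also have "\<dots> \<le> (\<Sum>j<M. \<Prod>l<m. h (x l) j ^ N) / M"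
      using c(4) by (intro divide_right_mono) auto
    also have "\<dots> \<le> (\<Prod>l<m. \<Sum>t\<in>{- int N..int N}. block_bound \<nu> N (p l) t)"
      unfolding h_def using \<nu> diss \<open>odd M\<close> big by (intro mean_lazy_char_le) auto
    also have "\<dots> \<le> (\<Prod>l<m. (4 / sqrt \<mu> + 2) / real (p l))"
      using \<nu> by (intro prod_mono conjI factor sum_nonneg) (auto simp: block_bound_def intro!: lazy_walk_nonneg)
    finally show ?thesis .
  qed
  then have "max_prob \<mu> v \<le> (\<Prod>l<m. (4 / sqrt \<mu> + 2) / real (p l))"
    unfolding max_prob_def using finite_range_pmf_walk_pmf by (intro Max.boundedI) auto
  then show ?thesis using that c(1,2,5) unfolding N_def by blast
qed


section \<open>Coordinates with respect to the free elements\<close>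

text \<open>
  The coordinates need not be unique: the elements \<open>x i\<close> are integers, and only the existence of a
  representation with a common denominator \<open>D\<close> and size at most \<open>B\<close> is of interest.
\<close>

definition has_coordinates :: "(nat \<Rightarrow> int) \<Rightarrow> nat set \<Rightarrow> nat \<Rightarrow> rat \<Rightarrow> rat \<Rightarrow> bool" where
  "has_coordinates x I D B z \<longleftrightarrow> (\<exists>c :: nat \<Rightarrow> rat. z = (\<Sum>i\<in>I. c i * of_int (x i)) \<and>
     (\<forall>i\<in>I. of_nat D * c i \<in> \<int> \<and> \<bar>c i\<bar> \<le> B))"

lemma has_coordinates_mono:
  assumes "has_coordinates x I D B z" "D dvd D'" "B \<le> B'"
  shows "has_coordinates x I D' B' z"
proof -
  obtain c where c: "z = (\<Sum>i\<in>I. c i * of_int (x i))" "\<forall>i\<in>I. of_nat D * c i \<in> \<int> \<and> \<bar>c i\<bar> \<le> B"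
    using assms(1) by (auto simp: has_coordinates_def)
  obtain e where e: "D' = D * e" using assms(2) by (elim dvdE)
  have "of_nat D' * c i \<in> \<int>" if "i \<in> I" for i
  proof -
    have "of_nat D' * c i = of_nat e * (of_nat D * c i)" by (simp add: e)
    then show ?thesis using c(2) that by (simp only: Ints_mult Ints_of_nat)
  qed
  then show ?thesis using c assms(3) unfolding has_coordinates_def by (intro exI[of _ c]) fastforce
qed

lemma has_coordinates_sum:
  fixes J :: "'j set"
  assumes "finite J" "\<And>j. j \<in> J \<Longrightarrow> has_coordinates x I D (B j) (z j)"
  shows "has_coordinates x I D (\<Sum>j\<in>J. \<bar>of_int (n j)\<bar> * B j) (\<Sum>j\<in>J. of_int (n j) * z j)"
proof -
  have "\<forall>j\<in>J. \<exists>c :: nat \<Rightarrow> rat. z j = (\<Sum>i\<in>I. c i * of_int (x i)) \<and> (\<forall>i\<in>I. of_nat D * c i \<in> \<int> \<and> \<bar>c i\<bar> \<le> B j)"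
    using assms(2) by (simp add: has_coordinates_def)
  from bchoice[OF this] obtain c :: "'j \<Rightarrow> nat \<Rightarrow> rat" where
    "\<forall>j\<in>J. z j = (\<Sum>i\<in>I. c j i * of_int (x i)) \<and> (\<forall>i\<in>I. of_nat D * c j i \<in> \<int> \<and> \<bar>c j i\<bar> \<le> B j)" ..
  then have c: "\<And>j. j \<in> J \<Longrightarrow> z j = (\<Sum>i\<in>I. c j i * of_int (x i))"
      "\<And>j i. j \<in> J \<Longrightarrow> i \<in> I \<Longrightarrow> of_nat D * c j i \<in> \<int> \<and> \<bar>c j i\<bar> \<le> B j"
    by simp_all
  define e where "e i = (\<Sum>j\<in>J. of_int (n j) * c j i)" for i
  have "(\<Sum>j\<in>J. of_int (n j) * z j) = (\<Sum>j\<in>J. \<Sum>i\<in>I. of_int (n j) * c j i * of_int (x i))"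
    using c(1) by (simp add: sum_distrib_left mult_ac)
  also have "\<dots> = (\<Sum>i\<in>I. e i * of_int (x i))"
    by (subst sum.swap) (simp add: e_def sum_distrib_right)
  finally have "(\<Sum>j\<in>J. of_int (n j) * z j) = (\<Sum>i\<in>I. e i * of_int (x i))" .
  moreover have "of_nat D * e i \<in> \<int>" if "i \<in> I" for i
  proof -
    have "of_nat D * e i = (\<Sum>j\<in>J. of_int (n j) * (of_nat D * c j i))"
      by (simp add: e_def sum_distrib_left mult_ac)
    then show ?thesis using c(2) that by (simp add: Ints_sum Ints_mult)
  qed
  moreover have "\<bar>e i\<bar> \<le> (\<Sum>j\<in>J. \<bar>of_int (n j)\<bar> * B j)" if "i \<in> I" for i
  proof -
    have "\<bar>e i\<bar> \<le> (\<Sum>j\<in>J. \<bar>of_int (n j) * c j i\<bar>)" unfolding e_def by (rule sum_abs)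
    also have "\<dots> \<le> (\<Sum>j\<in>J. \<bar>of_int (n j)\<bar> * B j)"
      using c(2) that by (intro sum_mono) (auto simp: abs_mult intro!: mult_left_mono)
    finally show ?thesis .
  qed
  ultimately show ?thesis unfolding has_coordinates_def by blast
qed

lemma has_coordinates_divide:
  assumes "has_coordinates x I D B (of_nat q * z)" "0 < q"
  shows "has_coordinates x I (q * D) (B / of_nat q) z"
proof -
  obtain c where c: "of_nat q * z = (\<Sum>i\<in>I. c i * of_int (x i))" "\<forall>i\<in>I. of_nat D * c i \<in> \<int> \<and> \<bar>c i\<bar> \<le> B"
    using assms(1) by (auto simp: has_coordinates_def)
  have "z = (of_nat q * z) / of_nat q" using assms(2) by simp
  also have "\<dots> = (\<Sum>i\<in>I. c i / of_nat q * of_int (x i))" by (simp add: c(1) sum_divide_distrib)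
  finally have "z = (\<Sum>i\<in>I. c i / of_nat q * of_int (x i))" .
  then show ?thesis using c(2) assms(2) unfolding has_coordinates_def
    by (intro exI[of _ "\<lambda>i. c i / of_nat q"]) (auto simp: abs_divide divide_right_mono)
qed

definition free_indices :: "(nat \<Rightarrow> int) \<Rightarrow> (nat \<Rightarrow> nat) \<Rightarrow> nat \<Rightarrow> nat set" where
  "free_indices x p m = {l. l < m \<and> int (p l) * x l \<notin> bounded_combinations x p l}"

definition tied_indices :: "(nat \<Rightarrow> int) \<Rightarrow> (nat \<Rightarrow> nat) \<Rightarrow> nat \<Rightarrow> nat set" where
  "tied_indices x p m = {l. l < m \<and> int (p l) * x l \<in> bounded_combinations x p l}"

lemma finite_indices: "finite (free_indices x p m)" "finite (tied_indices x p m)"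
  by (auto simp: free_indices_def tied_indices_def)

text \<open>
  The coefficient of \<open>x j\<close> is less than \<open>p j\<close>, which cancels the denominator in the size bound for \<open>x j\<close>.
  So the sizes add up to at most \<open>\<Sum>k 2\<^sup>j \<le> k 2\<^sup>l\<close>, and the growth is only exponential in the length.
\<close>

lemma bounded_combinations_coordinates:
  assumes p: "\<And>j. j < l \<Longrightarrow> 0 < p j"
    and coord: "\<And>j. j < l \<Longrightarrow> has_coordinates x I D (of_nat (k * 2 ^ j) / of_nat (p j)) (of_int (x j))"
    and z: "z \<in> bounded_combinations x p l"
  shows "has_coordinates x I D (of_nat (k * 2 ^ l)) (of_int z)"
proof -
  obtain n where n: "z = (\<Sum>j<l. n j * x j)" "\<forall>j<l. \<bar>n j\<bar> < int (p j)"
    using z by (auto simp: bounded_combinations_def)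
  have "has_coordinates x I D (\<Sum>j<l. \<bar>of_int (n j)\<bar> * (of_nat (k * 2 ^ j) / of_nat (p j))) (\<Sum>j<l. of_int (n j) * of_int (x j))"
    using coord by (intro has_coordinates_sum) auto
  moreover have "(\<Sum>j<l. \<bar>of_int (n j)\<bar> * (of_nat (k * 2 ^ j) / of_nat (p j)) :: rat) \<le> of_nat (k * 2 ^ l)"
  proof -
    have "(\<Sum>j<l. \<bar>of_int (n j)\<bar> * (of_nat (k * 2 ^ j) / of_nat (p j)) :: rat) \<le> (\<Sum>j<l. of_nat (k * 2 ^ j))"
    proof (intro sum_mono)
      fix j assume "j \<in> {..<l}"
      then have j: "0 < p j" "\<bar>n j\<bar> \<le> int (p j)" using p n(2) by auto
      then have "\<bar>of_int (n j)\<bar> \<le> (of_nat (p j) :: rat)"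
        by (metis of_int_abs of_int_le_iff of_int_of_nat_eq)
      then have "\<bar>of_int (n j)\<bar> * (of_nat (k * 2 ^ j) / of_nat (p j)) \<le> of_nat (p j) * (of_nat (k * 2 ^ j) / of_nat (p j) :: rat)"
        by (intro mult_right_mono) auto
      then show "\<bar>of_int (n j)\<bar> * (of_nat (k * 2 ^ j) / of_nat (p j)) \<le> (of_nat (k * 2 ^ j) :: rat)"
        using j by simp
    qed
    also have "\<dots> = of_nat (k * (\<Sum>j<l. 2 ^ j))" by (simp add: sum_distrib_left)
    also have "\<dots> \<le> of_nat (k * 2 ^ l)"
      by (intro of_nat_mono mult_left_mono) (auto simp: lessThan_atLeast0 sum_power2)
    finally show ?thesis .
  qed
  ultimately show ?thesis using n(1) by (auto intro: has_coordinates_mono)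
qed

text \<open>
  A free element is its own coordinate, and its size bound is at least \<open>1\<close> because \<open>p l = k\<close>. For a tied
  element, \<open>p l\<close> times it is a bounded combination of earlier ones, so \<open>p l\<close> divides the size bound and
  multiplies the denominator.
\<close>

lemma chain_coordinates:
  assumes chain: "dissociated_chain T k x p m" and "l < m"
  shows "has_coordinates x (free_indices x p m) (\<Prod>i\<in>tied_indices x p (Suc l). p i)
    (of_nat (k * 2 ^ l) / of_nat (p l)) (of_int (x l))"
  using \<open>l < m\<close>
proof (induction l rule: less_induct)
  case (less l)
  have p: "0 < p j" if "j < m" for j using chain that by (auto simp: dissociated_chain_def)
  show ?case
  proof (cases "l \<in> free_indices x p m")
    case True
    then have "p l = k" using chain by (auto simp: free_indices_def dissociated_chain_def)
    then have "1 \<le> (of_nat (k * 2 ^ l) / of_nat (p l) :: rat)" using p[OF less.prems] by simp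
    moreover have "of_int (x l) = (\<Sum>i\<in>free_indices x p m. (if i = l then 1 else 0) * of_int (x i) :: rat)"
    proof -
      have "(\<Sum>i\<in>free_indices x p m. (if i = l then 1 else 0) * of_int (x i) :: rat)
          = (\<Sum>i\<in>free_indices x p m. if i = l then of_int (x i) else 0)"
        by (intro sum.cong) auto
      then show ?thesis using True by (simp add: finite_indices)
    qed
    ultimately show ?thesis unfolding has_coordinates_def
      by (intro exI[of _ "\<lambda>i. if i = l then 1 else 0"]) auto
  next
    case False
    then have z: "int (p l) * x l \<in> bounded_combinations x p l"
      using less.prems by (auto simp: free_indices_def)
    then have "tied_indices x p (Suc l) = insert l (tied_indices x p l)"
      by (auto simp: tied_indices_def less_Suc_eq)
    then have D: "(\<Prod>i\<in>tied_indices x p (Suc l). p i) = p l * (\<Prod>i\<in>tied_indices x p l. p i)"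
      by (simp add: finite_indices) (simp add: tied_indices_def)
    have "has_coordinates x (free_indices x p m) (\<Prod>i\<in>tied_indices x p l. p i) (of_nat (k * 2 ^ l)) (of_int (int (p l) * x l))"
    proof (rule bounded_combinations_coordinates[OF _ _ z])
      fix j assume "j < l"
      then have sub: "tied_indices x p (Suc j) \<subseteq> tied_indices x p l" by (auto simp: tied_indices_def)
      show "has_coordinates x (free_indices x p m) (\<Prod>i\<in>tied_indices x p l. p i) (of_nat (k * 2 ^ j) / of_nat (p j)) (of_int (x j))"
        using less.IH[OF \<open>j < l\<close>] \<open>j < l\<close> less.prems sub
        by (auto intro: has_coordinates_mono prod_dvd_prod_subset finite_indices)
      show "0 < p j" using p \<open>j < l\<close> less.prems by simp
    qed
    then show ?thesis
      unfolding D using p[OF less.prems] by (intro has_coordinates_divide) (simp_all)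
  qed
qed

text \<open>
  The multiplier \<open>b \<le> T\<close> varies with the captured element; \<open>T!\<close> is a denominator that serves for all.
\<close>

lemma captured_coordinates:
  assumes chain: "dissociated_chain T k x p m" and cap: "captured T x p m y"
  shows "has_coordinates x (free_indices x p m) ((\<Prod>i\<in>tied_indices x p m. p i) * fact T) (of_nat (k * 2 ^ m)) (of_int y)"
proof -
  obtain b where b: "0 < b" "b \<le> T" "int b * y \<in> bounded_combinations x p m"
    using cap by (auto simp: captured_def)
  have "has_coordinates x (free_indices x p m) (\<Prod>i\<in>tied_indices x p m. p i) (of_nat (k * 2 ^ m)) (of_int (int b * y))"
  proof (rule bounded_combinations_coordinates[OF _ _ b(3)])
    fix j assume "j < m"
    then have sub: "tied_indices x p (Suc j) \<subseteq> tied_indices x p m" by (auto simp: tied_indices_def)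
    show "has_coordinates x (free_indices x p m) (\<Prod>i\<in>tied_indices x p m. p i) (of_nat (k * 2 ^ j) / of_nat (p j)) (of_int (x j))"
      using chain_coordinates[OF chain \<open>j < m\<close>] sub
      by (auto intro: has_coordinates_mono prod_dvd_prod_subset finite_indices)
    show "0 < p j" using chain \<open>j < m\<close> by (auto simp: dissociated_chain_def)
  qed
  then have "has_coordinates x (free_indices x p m) (b * (\<Prod>i\<in>tied_indices x p m. p i)) (of_nat (k * 2 ^ m) / of_nat b) (of_int y)"
    using b(1) by (intro has_coordinates_divide) simp_all
  then show ?thesis
  proof (rule has_coordinates_mono)
    have "b dvd fact T" using b by (intro dvd_fact) auto
    then show "b * (\<Prod>i\<in>tied_indices x p m. p i) dvd (\<Prod>i\<in>tied_indices x p m. p i) * fact T"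
      by (simp add: mult.commute mult_dvd_mono)
    show "of_nat (k * 2 ^ m) / of_nat b \<le> (of_nat (k * 2 ^ m) :: rat)"
      using b(1) mult_left_mono[of 1 "of_nat b" "of_nat (k * 2 ^ m) :: rat"] by (simp add: divide_le_eq)
  qed
qed

lemma gap_of_coordinates:
  fixes x :: "nat \<Rightarrow> int"
  assumes "finite I" "0 < s"
  shows "\<exists>Q. is_gap Q \<and> gap_rank Q = card I \<and> gap_volume Q = (2 * int (s * B) + 1) ^ card I \<and>
    (\<forall>u\<in>gap_generators Q. \<exists>i\<in>I. of_nat s * u = of_int (x i)) \<and>
    (\<forall>z. has_coordinates x I s (of_nat B) z \<longrightarrow> z \<in> gap_set Q)"
proof -
  obtain h where h: "bij_betw h {0..<card I} I"
    using ex_bij_betw_nat_finite[OF assms(1)] by blast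
  then have h: "bij_betw h {..<card I} I" by (simp add: lessThan_atLeast0)
  then have hI: "h j \<in> I" if "j < card I" for j using that by (auto dest: bij_betwE)
  define Q where "Q = \<lparr>gap_rank = card I, gap_base = 0, gap_gen = (\<lambda>j. of_int (x (h j)) / of_nat s),
    gap_lo = (\<lambda>_. - int (s * B)), gap_hi = (\<lambda>_. int (s * B))\<rparr>"
  have "z \<in> gap_set Q" if z: "has_coordinates x I s (of_nat B) z" for z
  proof -
    obtain c where c: "z = (\<Sum>i\<in>I. c i * of_int (x i))" "\<forall>i\<in>I. of_nat s * c i \<in> \<int> \<and> \<bar>c i\<bar> \<le> of_nat B"
      using z by (auto simp: has_coordinates_def)
    define n where "n j = \<lfloor>of_nat s * c (h j)\<rfloor>" for j
    have n: "of_int (n j) = of_nat s * c (h j)" if "j < card I" for j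
      using c(2) hI[OF that] by (simp add: n_def of_int_floor)
    have "- int (s * B) \<le> n j \<and> n j \<le> int (s * B)" if "j < card I" for j
    proof -
      have "of_int \<bar>n j\<bar> = of_nat s * \<bar>c (h j)\<bar>" using n[OF that] by (simp add: abs_mult)
      also have "\<dots> \<le> of_nat s * of_nat B" using c(2) hI[OF that] by (intro mult_left_mono) auto
      also have "\<dots> = (of_int (int (s * B)) :: rat)" by simp
      finally have "\<bar>n j\<bar> \<le> int (s * B)" by (simp only: of_int_le_iff)
      then show ?thesis by linarith
    qed
    moreover have "z = (\<Sum>j<card I. of_int (n j) * (of_int (x (h j)) / of_nat s))"
    proof -
      have "z = (\<Sum>j<card I. c (h j) * of_int (x (h j)))"
        unfolding c(1) using sum.reindex_bij_betw[OF h, of "\<lambda>i. c i * of_int (x i)"] by simp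
      also have "\<dots> = (\<Sum>j<card I. of_int (n j) * (of_int (x (h j)) / of_nat s))"
        using n assms(2) by (intro sum.cong) auto
      finally show ?thesis .
    qed
    ultimately show ?thesis unfolding gap_set_def Q_def by (intro CollectI exI[of _ n]) simp
  qed
  moreover have "\<exists>i\<in>I. of_nat s * u = of_int (x i)" if "u \<in> gap_generators Q" for u
    using that hI assms(2) by (auto simp: gap_generators_def Q_def)
  ultimately show ?thesis
    by (intro exI[of _ Q]) (auto simp: is_gap_def gap_volume_def Q_def mult.commute)
qed


section \<open>Size of the chain and conclusion\<close>

text \<open>
  The exponent is \<open>\<alpha> = 1 / (1 + \<gamma>)\<close>. The bound on \<open>T\<close> says that \<open>C\<^sub>1 \<le> T\<^sup>1\<^sup>-\<^sup>\<alpha>\<close>, so the constant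
  \<open>C\<^sub>1\<close> in each tied factor is absorbed into a small power of \<open>p l\<close>. In the at most \<open>d - 1\<close> free factors
  the constant is kept and compensated by \<open>C\<close>.
\<close>

lemma chain_size_bounds:
  fixes C C\<^sub>1 \<gamma> :: real
  assumes chain: "dissociated_chain T k x p m"
    and "0 < \<gamma>" "1 \<le> C\<^sub>1" "C\<^sub>1 powr ((1 + \<gamma>) / \<gamma>) \<le> T" "C\<^sub>1 ^ d < C"
    and lower: "C * real k powr (- real d) \<le> (\<Prod>l<m. C\<^sub>1 / real (p l))" and "T < k"
  shows "card (free_indices x p m) < d"
    and "real (\<Prod>i\<in>tied_indices x p m. p i) \<le> real k powr (real d * (1 + \<gamma>))"
    and "real T ^ card (tied_indices x p m) \<le> real (\<Prod>i\<in>tied_indices x p m. p i)"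
    and "m = card (free_indices x p m) + card (tied_indices x p m)"
proof -
  let ?F = "free_indices x p m" and ?J = "tied_indices x p m"
  define \<alpha> where "\<alpha> = 1 / (1 + \<gamma>)"
  have \<alpha>: "0 < \<alpha>" "\<alpha> < 1" using \<open>0 < \<gamma>\<close> by (auto simp: \<alpha>_def)
  have k: "0 < real k" "1 \<le> real k" using \<open>T < k\<close> by auto
  have part: "{..<m} = ?F \<union> ?J" "?F \<inter> ?J = {}" by (auto simp: free_indices_def tied_indices_def)
  show m: "m = card ?F + card ?J"
    using card_Un_disjoint[OF finite_indices part(2)] part(1) by (metis card_lessThan)
  have p: "T < p l" if "l < m" for l using chain that by (auto simp: dissociated_chain_def)
  have pF: "p l = k" if "l \<in> ?F" for l
    using chain that by (auto simp: dissociated_chain_def free_indices_def)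
  have gain: "C\<^sub>1 / real q \<le> real q powr (- \<alpha>)" if "T < q" for q
  proof -
    have "1 - \<alpha> = \<gamma> / (1 + \<gamma>)" using assms(2) by (simp add: \<alpha>_def field_simps)
    moreover have "1 + \<gamma> \<noteq> 0" using assms(2) by simp
    ultimately have "(1 + \<gamma>) / \<gamma> * (1 - \<alpha>) = 1" using assms(2) by simp
    then have "C\<^sub>1 = (C\<^sub>1 powr ((1 + \<gamma>) / \<gamma>)) powr (1 - \<alpha>)"
      using assms(3) by (simp add: powr_powr)
    also have "\<dots> \<le> real q powr (1 - \<alpha>)"
      using \<alpha> assms(4) that by (intro powr_mono2) auto
    also have "\<dots> = real q * real q powr (- \<alpha>)" using that by (simp add: powr_diff powr_minus field_simps)
    finally show ?thesis using that by (simp add: field_simps)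
  qed
  define s where "s = (\<Prod>i\<in>?J. p i)"
  have pJ: "T < p i" if "i \<in> ?J" for i using p that by (auto simp: tied_indices_def)
  have s1: "1 \<le> s" unfolding s_def using pJ by (intro prod_ge_1) force
  have "(\<Prod>l<m. C\<^sub>1 / real (p l)) = (\<Prod>l\<in>?F. C\<^sub>1 / real (p l)) * (\<Prod>l\<in>?J. C\<^sub>1 / real (p l))"
    unfolding part(1) by (intro prod.union_disjoint finite_indices part(2))
  also have "(\<Prod>l\<in>?F. C\<^sub>1 / real (p l)) = (C\<^sub>1 / k) ^ card ?F" using pF by simp
  also have "(\<Prod>l\<in>?J. C\<^sub>1 / real (p l)) \<le> (\<Prod>l\<in>?J. real (p l) powr (- \<alpha>))"
    using gain pJ assms(3) by (intro prod_mono) auto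
  also have "(\<Prod>l\<in>?J. real (p l) powr (- \<alpha>)) = real s powr (- \<alpha>)"
    unfolding s_def by (simp add: prod_powr_distrib)
  finally have upper: "(\<Prod>l<m. C\<^sub>1 / real (p l)) \<le> (C\<^sub>1 / k) ^ card ?F * real s powr (- \<alpha>)"
    using assms(3) by (simp add: mult_left_mono)
  have key: "C * real k powr (- real d) \<le> (C\<^sub>1 / k) ^ card ?F * real s powr (- \<alpha>)"
    using lower upper by simp
  have kd: "real k powr (- real d) = 1 / real k ^ d" using k by (simp add: powr_minus powr_realpow field_simps)
  \<comment> \<open>With \<open>d\<close> or more free indices the upper bound would be at most \<open>(C\<^sub>1 / k)\<^sup>d\<close>.\<close>
  show card: "card ?F < d"
  proof (rule ccontr)
    assume "\<not> ?thesis"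
    then have "d \<le> card ?F" by simp
    have "C\<^sub>1 / k \<le> real k powr (- \<alpha>)" using gain \<open>T < k\<close> by simp
    also have "\<dots> \<le> real k powr 0" using k \<alpha> by (intro powr_mono) auto
    finally have "C\<^sub>1 / k \<le> 1" using k by simp
    then have "(C\<^sub>1 / k) ^ card ?F \<le> (C\<^sub>1 / k) ^ d"
      using \<open>d \<le> card ?F\<close> assms(3) k by (intro power_decreasing) auto
    moreover have "real s powr (- \<alpha>) \<le> real s powr 0" using s1 \<alpha> by (intro powr_mono) auto
    then have "real s powr (- \<alpha>) \<le> 1" using s1 by simp
    ultimately have "(C\<^sub>1 / k) ^ card ?F * real s powr (- \<alpha>) \<le> (C\<^sub>1 / k) ^ d * 1"
      using assms(3) k by (intro mult_mono) auto
    then have "C / real k ^ d \<le> C\<^sub>1 ^ d / real k ^ d" using key kd by (simp add: power_divide)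
    then show False using \<open>C\<^sub>1 ^ d < C\<close> k by (simp add: divide_le_cancel)
  qed
  have "C\<^sub>1 ^ d * real k powr (- real d) \<le> C * real k powr (- real d)"
    using \<open>C\<^sub>1 ^ d < C\<close> by (intro mult_right_mono) auto
  also have "\<dots> \<le> (C\<^sub>1 / k) ^ card ?F * real s powr (- \<alpha>)" by (rule key)
  also have "\<dots> \<le> C\<^sub>1 ^ d * real s powr (- \<alpha>)"
  proof (intro mult_right_mono)
    have "(C\<^sub>1 / k) ^ card ?F \<le> C\<^sub>1 ^ card ?F" using k assms(3) by (intro power_mono) (auto simp: field_simps)
    also have "\<dots> \<le> C\<^sub>1 ^ d" using card assms(3) by (intro power_increasing) auto
    finally show "(C\<^sub>1 / k) ^ card ?F \<le> C\<^sub>1 ^ d" .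
  qed simp
  finally have "real k powr (- real d) \<le> real s powr (- \<alpha>)" using assms(3) by simp
  then have "real s powr \<alpha> \<le> real k powr real d"
    using s1 k by (simp add: powr_minus le_imp_inverse_le field_simps)
  then have "(real s powr \<alpha>) powr (1 + \<gamma>) \<le> (real k powr real d) powr (1 + \<gamma>)"
    using assms(2) by (intro powr_mono2) auto
  then show "real (\<Prod>i\<in>?J. p i) \<le> real k powr (real d * (1 + \<gamma>))"
    using assms(2) s1 by (simp add: powr_powr \<alpha>_def s_def)
  have "(\<Prod>i\<in>?J. real T) \<le> (\<Prod>i\<in>?J. real (p i))"
    using pJ by (intro prod_mono) (auto simp: less_imp_le)
  then show "real T ^ card ?J \<le> real (\<Prod>i\<in>?J. p i)" by simp
qed

theorem theorem2p5:
  fixes \<mu> \<epsilon> :: real and d :: nat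
  assumes "0 < \<mu>" and "\<mu> \<le> 1" and "\<epsilon> > 0" and "d > 0"
  shows "\<exists>C k\<^sub>0 :: real. C \<ge> 1 \<and> k\<^sub>0 \<ge> 1 \<and>
    (\<forall>(k :: nat) (v :: int list).
       real k \<ge> k\<^sub>0 \<and> max_prob \<mu> v \<ge> C * real k powr (- real d) \<longrightarrow>
       (\<exists>Q :: gap. is_gap Q \<and>
          gap_rank Q \<le> d - 1 \<and>
          real_of_int (gap_volume Q) \<le> real k powr (2 * ((real d)\<^sup>2 - 1) + \<epsilon>) \<and>
          real (length (filter (\<lambda>x. rat_of_int x \<notin> gap_set Q) v)) \<le> \<epsilon> * (real k)\<^sup>2 * ln (real k) \<and>
          (\<exists>s :: nat. s > 0 \<and> real s \<le> real k powr (real d + \<epsilon>) \<and>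
             (\<forall>u \<in> gap_generators Q. rat_of_nat s * u \<in> rat_of_int ` set v))))"
proof -
  define \<delta> where "\<delta> = min \<epsilon> 1"
  have \<delta>: "0 < \<delta>" "\<delta> \<le> \<epsilon>" "\<delta> \<le> 1" using assms by (auto simp: \<delta>_def)
  define \<gamma> where "\<gamma> = \<delta> / (2 * d)"
  have \<gamma>: "0 < \<gamma>" "real d * (1 + \<gamma>) = d + \<delta> / 2"
    using \<delta> assms by (auto simp: \<gamma>_def field_simps)
  define C\<^sub>1 where "C\<^sub>1 = 4 / sqrt \<mu> + 2"
  have C1: "1 \<le> C\<^sub>1" using assms by (simp add: C\<^sub>1_def add_increasing)
  define C where "C = C\<^sub>1 ^ d + 1"
  \<comment> \<open>The first bound makes \<open>chain_size_bounds\<close> applicable. The second one makes the number of tied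
    indices at most \<open>(\<delta> / 2) ln k\<close>, which gives both \<open>m + 1 \<le> \<epsilon> ln k\<close> and \<open>2\<^sup>m \<le> 2\<^sup>d k\<^sup>1\<^sup>/\<^sup>2\<close>.\<close>
  define T where "T = nat \<lceil>max (C\<^sub>1 powr ((1 + \<gamma>) / \<gamma>)) (exp (2 * (d + 1) / \<delta>))\<rceil>"
  have T: "C\<^sub>1 powr ((1 + \<gamma>) / \<gamma>) \<le> T" "exp (2 * (d + 1) / \<delta>) \<le> T"
    unfolding T_def by linarith+
  have "0 < real T" using T(2) by (smt (verit) exp_gt_zero)
  then have T0: "0 < T" by simp
  have lnT: "2 * (d + 1) / \<delta> \<le> ln T"
    using T(2) \<open>0 < real T\<close> by (simp add: ln_ge_iff)
  \<comment> \<open>In turn: chains exist, \<open>T! \<le> k\<^sup>\<delta>\<^sup>/\<^sup>2\<close>, \<open>3 \<cdot> 2\<^sup>d \<le> k\<^sup>1\<^sup>/\<^sup>2\<close>, and \<open>d \<le> (\<delta> / 2) ln k\<close>.\<close>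
  define k\<^sub>0 where "k\<^sub>0 = Max {real T + 1, (fact T) powr (2 / \<delta>), (3 * 2 ^ d) powr 2, exp (2 * d / \<delta>)}"
  have k0: "real T + 1 \<le> k\<^sub>0" "(fact T) powr (2 / \<delta>) \<le> k\<^sub>0" "(3 * 2 ^ d) powr 2 \<le> k\<^sub>0" "exp (2 * d / \<delta>) \<le> k\<^sub>0"
    unfolding k\<^sub>0_def by (intro Max_ge; simp)+
  show ?thesis
  proof (rule exI[of _ C], rule exI[of _ k\<^sub>0], intro conjI allI impI)
    show "1 \<le> C" using C1 by (simp add: C_def)
    show "1 \<le> k\<^sub>0" using k0(1) by simp
  next
    fix k :: nat and v :: "int list"
    assume "k\<^sub>0 \<le> real k \<and> C * real k powr (- real d) \<le> max_prob \<mu> v"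
    then have kk: "k\<^sub>0 \<le> real k" and P: "C * real k powr (- real d) \<le> max_prob \<mu> v" by auto
    have Tk: "T < k" using k0(1) kk by linarith
    have k1: "1 < real k" using T0 Tk by linarith
    obtain x p m where c: "dissociated_chain T k x p m" "\<And>l. l < m \<Longrightarrow> x l \<in> set v"
      "max_prob \<mu> v \<le> (\<Prod>l<m. C\<^sub>1 / real (p l))"
      "length (filter (\<lambda>y. \<not> captured T x p m y) v) < (m + 1) * k\<^sup>2"
      using chain_extraction[OF assms(1,2) Tk, of v] unfolding C\<^sub>1_def by blast
    let ?I = "free_indices x p m" and ?J = "tied_indices x p m"
    define s\<^sub>0 where "s\<^sub>0 = (\<Prod>i\<in>?J. p i)"
    define s where "s = s\<^sub>0 * fact T"
    have "C\<^sub>1 ^ d < C" by (simp add: C_def)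
    note size = chain_size_bounds[OF c(1) \<gamma>(1) C1 T(1) \<open>C\<^sub>1 ^ d < C\<close> order_trans[OF P c(3)] Tk]
    have "0 < s\<^sub>0" unfolding s\<^sub>0_def using c(1) by (intro prod_pos) (auto simp: dissociated_chain_def tied_indices_def)
    then have "0 < s" by (simp add: s_def)
    have s0: "real s\<^sub>0 \<le> real k powr (d + \<delta> / 2)" using size(2) \<gamma>(2) by (simp add: s\<^sub>0_def)
    have s: "real s \<le> real k powr (d + \<delta>)"
    proof -
      have "(fact T :: real) = ((fact T) powr (2 / \<delta>)) powr (\<delta> / 2)" using \<delta> by (simp add: powr_powr)
      also have "\<dots> \<le> real k powr (\<delta> / 2)" using k0(2) kk \<delta> by (intro powr_mono2) auto
      finally have "real s \<le> real k powr (d + \<delta> / 2) * real k powr (\<delta> / 2)"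
        using s0 by (simp add: s_def mult_mono)
      then show ?thesis using k1 by (simp add: powr_add[symmetric] add.commute)
    qed
    have J: "card ?J \<le> \<delta> / 2 * ln k"
    proof -
      have "real T ^ card ?J \<le> real k powr (d + \<delta> / 2)" using size(3) s0 by (simp add: s\<^sub>0_def)
      then have "ln (real T ^ card ?J) \<le> ln (real k powr (d + \<delta> / 2))"
        using \<open>0 < real T\<close> k1 by (subst ln_le_cancel_iff) auto
      then have "card ?J * ln T \<le> (d + \<delta> / 2) * ln k"
        using \<open>0 < real T\<close> k1 by (simp add: ln_realpow ln_powr)
      moreover have "card ?J * (2 * (d + 1) / \<delta>) \<le> card ?J * ln T" using lnT by (intro mult_left_mono) auto
      moreover have "(d + \<delta> / 2) * ln k \<le> (d + 1) * ln k" using \<delta> k1 by (intro mult_right_mono) auto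
      ultimately have "card ?J * (2 * (d + 1) / \<delta>) \<le> (d + 1) * ln k" by linarith
      then have "real (d + 1) * real (card ?J) \<le> real (d + 1) * (\<delta> / 2 * ln k)" using \<delta> by (simp add: field_simps)
      then show ?thesis by (subst (asm) mult_le_cancel_left_pos) auto
    qed
    have d: "d \<le> \<delta> / 2 * ln k"
    proof -
      have "2 * d / \<delta> \<le> ln k" using k0(4) kk k1 by (simp add: ln_ge_iff)
      then show ?thesis using \<delta> by (simp add: field_simps)
    qed
    obtain Q where Q: "is_gap Q" "gap_rank Q = card ?I" "gap_volume Q = (2 * int (s * (k * 2 ^ m)) + 1) ^ card ?I"
      "\<And>u. u \<in> gap_generators Q \<Longrightarrow> \<exists>i\<in>?I. of_nat s * u = of_int (x i)"
      "\<And>z. has_coordinates x ?I s (of_nat (k * 2 ^ m)) z \<Longrightarrow> z \<in> gap_set Q"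
      using gap_of_coordinates[OF finite_indices(1) \<open>0 < s\<close>, of x p m "k * 2 ^ m" x] by blast
    have vol: "real_of_int (gap_volume Q) \<le> real k powr (2 * ((real d)\<^sup>2 - 1) + \<epsilon>)"
    proof -
      \<comment> \<open>Each side of the GAP has length at most \<open>3 s k 2\<^sup>m\<close>, which is at most
        \<open>k\<^sup>d\<^sup>+\<^sup>3 \<le> k\<^sup>2\<^sup>d\<^sup>+\<^sup>2\<close>; there are at most \<open>d - 1\<close> sides.\<close>
      have "(2 :: real) ^ card ?J \<le> exp 1 ^ card ?J"
        using exp_ge_add_one_self[of "1 :: real"] by (intro power_mono) auto
      also have "\<dots> = exp (real (card ?J))" by (simp add: exp_of_nat_mult[symmetric])
      also have "\<dots> \<le> exp (1 / 2 * ln k)"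
      proof -
        have "\<delta> / 2 * ln k \<le> 1 / 2 * ln k" using \<delta> k1 by (intro mult_right_mono) auto
        with J have "card ?J \<le> 1 / 2 * ln k" by (rule order_trans)
        then show ?thesis by (simp only: exp_le_cancel_iff)
      qed
      also have "\<dots> = real k powr (1 / 2)" using k1 by (simp add: powr_def)
      finally have J2: "2 ^ card ?J \<le> real k powr (1 / 2)" by simp
      have "3 * 2 ^ d = ((3 * 2 ^ d) powr 2) powr (1 / 2 :: real)" by (subst powr_powr) simp
      also have "\<dots> \<le> real k powr (1 / 2)" using k0(3) kk by (intro powr_mono2) auto
      finally have d2: "3 * 2 ^ d \<le> real k powr (1 / 2)" .
      have "real (2 ^ m) = 2 ^ card ?I * 2 ^ card ?J" by (subst size(4)) (simp add: power_add)
      also have "\<dots> \<le> 2 ^ d * real k powr (1 / 2)"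
        using size(1) J2 by (intro mult_mono power_increasing) auto
      finally have m2: "real (2 ^ m) \<le> 2 ^ d * real k powr (1 / 2)" .
      have "real s \<le> real k powr (d + 1)"
        using s \<delta> k1 by (elim order_trans) (intro powr_mono, auto)
      then have "real s * (k * 2 ^ m) \<le> real k powr (d + 1) * (k * (2 ^ d * real k powr (1 / 2)))"
        using m2 by (intro mult_mono) (auto intro: mult_left_mono)
      then have "3 * (real s * (k * 2 ^ m)) \<le> (3 * 2 ^ d) * (real k powr (d + 1) * (k * real k powr (1 / 2)))"
        by (simp add: mult_ac)
      also have "\<dots> \<le> real k powr (1 / 2) * (real k powr (d + 1) * (k powr 1 * real k powr (1 / 2)))"
        using d2 by (intro mult_mono) auto
      also have "\<dots> = real k powr (d + 3)" by (simp only: powr_add[symmetric]) (simp add: algebra_simps)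
      also have "\<dots> \<le> real k powr (2 * d + 2)" using k1 assms(4) by (intro powr_mono) auto
      finally have "3 * (real s * (k * 2 ^ m)) \<le> real k powr (2 * d + 2)" .
      moreover have "1 \<le> s * (k * 2 ^ m)" using \<open>0 < s\<close> Tk by simp
      then have "1 \<le> real (s * (k * 2 ^ m))" by (simp only: real_of_nat_ge_one_iff)
      ultimately have one: "2 * real (s * (k * 2 ^ m)) + 1 \<le> real k powr (2 * d + 2)" by simp
      have "real_of_int (gap_volume Q) = (2 * real (s * (k * 2 ^ m)) + 1) ^ card ?I" unfolding Q(3) by simp
      also have "\<dots> \<le> (real k powr (2 * d + 2)) ^ card ?I" using one by (intro power_mono) auto
      also have "\<dots> = real k powr ((2 * d + 2) * card ?I)" using k1 by (simp add: powr_power algebra_simps)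
      also have "\<dots> \<le> real k powr (2 * ((real d)\<^sup>2 - 1) + \<epsilon>)"
      proof (intro powr_mono)
        have "real (card ?I) \<le> real d - 1" using size(1) by linarith
        then have "(2 * d + 2) * real (card ?I) \<le> (2 * d + 2) * (real d - 1)" by (intro mult_left_mono) auto
        then show "real ((2 * d + 2) * card ?I) \<le> 2 * ((real d)\<^sup>2 - 1) + \<epsilon>"
          using assms(3) by (simp add: power2_eq_square algebra_simps)
      qed (use k1 in simp)
      finally show ?thesis .
    qed
    have exc: "real (length (filter (\<lambda>x. rat_of_int x \<notin> gap_set Q) v)) \<le> \<epsilon> * (real k)\<^sup>2 * ln (real k)"
    proof -
      have "captured T x p m y \<Longrightarrow> rat_of_int y \<in> gap_set Q" for y
        using Q(5) captured_coordinates[OF c(1)] by (simp add: s_def s\<^sub>0_def)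
      then have "length (filter (\<lambda>y. rat_of_int y \<notin> gap_set Q) v) \<le> length (filter (\<lambda>y. \<not> captured T x p m y) v)"
        unfolding length_filter_conv_card by (intro card_mono) auto
      also have "\<dots> \<le> (m + 1) * k\<^sup>2" using c(4) by simp
      finally have "real (length (filter (\<lambda>y. rat_of_int y \<notin> gap_set Q) v)) \<le> real (m + 1) * (real k)\<^sup>2"
        by (metis of_nat_le_iff of_nat_mult of_nat_power)
      also have "\<dots> \<le> (\<epsilon> * ln k) * (real k)\<^sup>2"
      proof (rule mult_right_mono)
        have "real (m + 1) \<le> \<delta> * ln k" using size(1,4) J d by (simp add: field_simps)
        also have "\<dots> \<le> \<epsilon> * ln k" using \<delta> k1 by (intro mult_right_mono) auto
        finally show "real (m + 1) \<le> \<epsilon> * ln k" .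
      qed simp
      finally show ?thesis by (simp add: mult_ac)
    qed
    have gen: "rat_of_nat s * u \<in> rat_of_int ` set v" if "u \<in> gap_generators Q" for u
      using Q(4)[OF that] c(2) by (auto simp: free_indices_def)
    have s': "real s \<le> real k powr (d + \<epsilon>)"
      using s \<delta> k1 by (elim order_trans) (intro powr_mono, auto)
    show "\<exists>Q :: gap. is_gap Q \<and>
          gap_rank Q \<le> d - 1 \<and>
          real_of_int (gap_volume Q) \<le> real k powr (2 * ((real d)\<^sup>2 - 1) + \<epsilon>) \<and>
          real (length (filter (\<lambda>x. rat_of_int x \<notin> gap_set Q) v)) \<le> \<epsilon> * (real k)\<^sup>2 * ln (real k) \<and>
          (\<exists>s :: nat. s > 0 \<and> real s \<le> real k powr (real d + \<epsilon>) \<and>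
             (\<forall>u \<in> gap_generators Q. rat_of_nat s * u \<in> rat_of_int ` set v))"
      using Q(1,2) size(1) vol exc gen s' \<open>0 < s\<close> by (intro exI[of _ Q] conjI exI[of _ s] ballI) auto
  qed
qed

end
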